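(* Let $\mathcal S=((x_n,r_n))_{n\ge1}$ be a system with $x_n\in(0,1)^d$ for all $n$, and assume that $\limsup_{n\to\infty}B(x_n,r_n)=(0,1)^d$ (i.e. every $x\in(0,1)^d$ belongs to $B(x_n,r_n)$ for infinitely many $n$), and that $\mathcal S$ satisfies conditions $\mathcal C_1$ and $\mathcal C_2$. Let $\Omega$ be a non-empty compact subset of $(0,1)^d$ such that the closure of the interior of $\Omega$ equals $\Omega$. Let $f:(0,1)^d\to[1,+\infty)$ be continuous, and define $$\mathcal L(\Omega,f)=\{x\in\Omega:\ \delta_x\ge f(x)\},\qquad \widetilde{\mathcal L}(\Omega,f)=\{x\in\Omega:\ \delta_x=f(x)\}.$$ Then $\mathcal L(\Omega,f)$ and $\widetilde{\mathcal L}(\Omega,f)$ are dense in $\Omega$, and $$\dim_{\mathcal H}\mathcal L(\Omega,f)=\dim_{\mathcal H}\widetilde{\mathcal L}(\Omega,f)=\frac{d}{\min\{f(x):x\in\Omega\}}.$$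
   Context: Work in $\mathbb R^d$ ($d\ge1$) with the $L^\infty$ norm $\|\cdot\|$; $B(x,r)=\{y:\|y-x\|\le r\}$ and $|A|$ denotes the diameter of a set $A$; $\dim_{\mathcal H}$ is Hausdorff dimension; $[y]$ is the integer part of $y$. A system is a sequence $\mathcal S=((x_n,r_n))_{n\ge1}$ with $x_n\in[0,1]^d$ and $(r_n)$ a non-increasing sequence of positive reals tending to $0$; we write $(x,r)\in\mathcal S$ if $(x,r)=(x_n,r_n)$ for some $n$. For $\delta>0$, $\mathcal L_\delta=\{x\in[0,1]^d:\|x-x_n\|\le r_n^\delta$ for infinitely many $n\}$, and the approximation rate of $x$ is $\delta_x=\sup\{\delta>0:x\in\mathcal L_\delta\}$ (with $\sup\emptyset=0$). Irreducible subsystem: $((y_n,\rho_n))_{n\ge1}$ is the subsequence of $((x_n,r_n))$ consisting of those indices $n$ with $n=\min\{p\ge1:x_p=x_n\}$. For $j\ge0$, $\mathcal T_j=\{n:2^{-(j+1)}<\rho_n\le2^{-j}\}$. Condition $\mathcal C_1$: there is a non-decreasing sequence of positive integers $(N_j)_{j\ge0}$ with $\lim_{j\to\infty}(\log_2N_j)/j=0$ such that for every $j\ge1$, $\mathcal T_j$ can be decomposed into at most $N_j$ pairwise disjoint subsets $\mathcal T_{j,1},\dots,\mathcal T_{j,N_j}$ such that for each $i$ the balls $B(y_n,\rho_n)$, $n\in\mathcal T_{j,i}$, are pairwise disjoint. Given such $(N_j)$, let $\psi:\mathbb R_+\to\mathbb R_+$ be a continuous function with $\psi(0)=0$ and $N_j=2^{dj\psi(2^{-j})}$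 for all $j\ge1$. $\Phi$ is the set of functions $\varphi:\mathbb R_+\to\mathbb R_+$ that are non-decreasing, continuous, with $\varphi(0)=0$, such that $r\mapsto r^{-\varphi(r)}$ is decreasing and tends to $+\infty$ as $r\to0^+$, and such that for all $\alpha,\beta>0$ the map $r\mapsto r^{\alpha-\beta\varphi(r)}$ is increasing in a neighbourhood of $0$. For $\varphi\in\Phi$ and $j\ge1$, $\gamma(j)=\max\{k\in\mathbb N: N_k2^{dk}\le 2^{-dj\varphi(2^{-j})}2^{dj}\}$. $\mathcal G_j$ is the set of dyadic subcubes of $[0,1]^d$ of side $2^{-j}$, $\mathcal G_*=\bigcup_{j\ge1}\mathcal G_j$, and for $I\in\mathcal G_*$, $g(I)=-\log_2|I|$ is its generation. Property $\mathcal P(V,\delta)$ (for $V\in\mathcal G_*$, $\delta>1$, relative to fixed $\varphi$ and $(N_j)$): there exist $x(V)\in V$ and $r(V)>0$ with $(x(V),r(V))\in\mathcal S$, $2^{-g(V)-1}\le r(V)<2^{-g(V)}$, and $B(x(V),r(V)^\delta)\cap\{x_p:\gamma(g(V))\le-\log_2r_p<[\delta(g(V)+1)]+4\}=\{x(V)\}$. For a dyadic cube $U$, $j\ge g(U)$, $\delta>1$: $\mathcal Q(U,j,\delta)=\{V\in\mathcal G_j:V\subset U,\ \mathcal P(V,\delta)\text{ holds}\}$. Condition $\mathcal C_2$: $\mathcal S$ satisfies $\mathcal C_1$ and there exist $\varphi\in\Phi$, a sequence $(N_j)$ as in $\mathcal C_1$, a continuous function $\kappa:(1,\infty)\to(0,1]$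 and a dense subset $\Delta\subset(1,\infty)$ such that for every $\delta\in\Delta$ and every dyadic cube $U\subset[0,1]^d$ there are infinitely many integers $j\ge g(U)$ with $\#\mathcal Q(U,j,\delta)\ge\kappa(\delta)2^{d(j-g(U))}$. *)

theory Defs
  imports "HOL-Analysis.Analysis"
begin

definition linf_dist :: "real^'d \<Rightarrow> real^'d \<Rightarrow> real" where
  "linf_dist x y = Max (range (\<lambda>i. \<bar>x$i - y$i\<bar>))"

definition cball_inf :: "real^'d \<Rightarrow> real \<Rightarrow> (real^'d) set" where
  "cball_inf x \<rho> = {y. linf_dist x y \<le> \<rho>}"

definition diam_inf :: "(real^'d) set \<Rightarrow> real" where
  "diam_inf A = (if A = {} then 0 else Sup {linf_dist a b | a b. a \<in> A \<and> b \<in> A})"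

definition closed_unit_cube :: "(real^'d) set" where
  "closed_unit_cube = {y. \<forall>i. 0 \<le> y$i \<and> y$i \<le> 1}"

definition open_unit_cube :: "(real^'d) set" where
  "open_unit_cube = {y. \<forall>i. 0 < y$i \<and> y$i < 1}"

definition hausdorff_content :: "real \<Rightarrow> real \<Rightarrow> (real^'d) set \<Rightarrow> ennreal" where
  "hausdorff_content s \<epsilon> E =
     (INF U \<in> {U :: nat \<Rightarrow> (real^'d) set. E \<subseteq> (\<Union>i. U i) \<and>
                 (\<forall>i. bounded (U i) \<and> diam_inf (U i) \<le> \<epsilon>)}.
        (\<Sum>i. ennreal (diam_inf (U i) powr s)))"

definition hausdorff_measure :: "real \<Rightarrow> (real^'d) set \<Rightarrow> ennreal" where
  "hausdorff_measure s E = (SUP \<epsilon> \<in> {0<..}. hausdorff_content s \<epsilon> E)"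

definition hausdorff_dim :: "(real^'d) set \<Rightarrow> real" where
  "hausdorff_dim E = Inf {s. 0 \<le> s \<and> hausdorff_measure s E = 0}"

text \<open>A system is indexed by natural numbers starting at 0 (instead of 1).\<close>

definition is_system :: "(nat \<Rightarrow> real^'d) \<Rightarrow> (nat \<Rightarrow> real) \<Rightarrow> bool" where
  "is_system x r \<longleftrightarrow> (\<forall>n. x n \<in> closed_unit_cube) \<and> (\<forall>n. 0 < r n) \<and>
     decseq r \<and> r \<longlonglongrightarrow> 0"

definition L_set :: "(nat \<Rightarrow> real^'d) \<Rightarrow> (nat \<Rightarrow> real) \<Rightarrow> real \<Rightarrow> (real^'d) set" where
  "L_set x r \<delta> = {y \<in> closed_unit_cube. infinite {n. linf_dist y (x n) \<le> r n powr \<delta>}}"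

text \<open>Approximation rate; may be infinite, hence extended real. sup of empty set is 0.\<close>
definition approx_rate :: "(nat \<Rightarrow> real^'d) \<Rightarrow> (nat \<Rightarrow> real) \<Rightarrow> real^'d \<Rightarrow> ereal" where
  "approx_rate x r y =
     (if {\<delta>::real. 0 < \<delta> \<and> y \<in> L_set x r \<delta>} = {} then 0
      else Sup (ereal ` {\<delta>::real. 0 < \<delta> \<and> y \<in> L_set x r \<delta>}))"

definition irred_idx :: "(nat \<Rightarrow> real^'d) \<Rightarrow> nat set" where
  "irred_idx x = {n. n = (LEAST p. x p = x n)}"

definition T_idx :: "(nat \<Rightarrow> real^'d) \<Rightarrow> (nat \<Rightarrow> real) \<Rightarrow> nat \<Rightarrow> nat set" where
  "T_idx x r j = {n \<in> irred_idx x. (1/2) ^ (j+1) < r n \<and> r n \<le> (1/2) ^ j}"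

definition C1_with :: "(nat \<Rightarrow> real^'d) \<Rightarrow> (nat \<Rightarrow> real) \<Rightarrow> (nat \<Rightarrow> nat) \<Rightarrow> bool" where
  "C1_with x r N \<longleftrightarrow>
     mono N \<and> (\<forall>j. 0 < N j) \<and>
     ((\<lambda>j. log 2 (real (N j)) / real j) \<longlonglongrightarrow> 0) \<and>
     (\<forall>j\<ge>1. \<exists>c :: nat \<Rightarrow> nat.
         (\<forall>n \<in> T_idx x r j. c n < N j) \<and>
         (\<forall>n \<in> T_idx x r j. \<forall>m \<in> T_idx x r j. n \<noteq> m \<and> c n = c m \<longrightarrow>
             cball_inf (x n) (r n) \<inter> cball_inf (x m) (r m) = {}))"

definition C1 :: "(nat \<Rightarrow> real^'d) \<Rightarrow> (nat \<Rightarrow> real) \<Rightarrow> bool" where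
  "C1 x r \<longleftrightarrow> (\<exists>N. C1_with x r N)"

definition Phi_class :: "(real \<Rightarrow> real) set" where
  "Phi_class = {\<phi>.
     mono_on {0..} \<phi> \<and> continuous_on {0..} \<phi> \<and> \<phi> 0 = 0 \<and> (\<forall>t\<ge>0. 0 \<le> \<phi> t) \<and>
     antimono_on {0<..} (\<lambda>t. t powr (- \<phi> t)) \<and>
     filterlim (\<lambda>t. t powr (- \<phi> t)) at_top (at_right 0) \<and>
     (\<forall>\<alpha>>0. \<forall>\<beta>>0. \<exists>\<epsilon>>0. mono_on {0<..<\<epsilon>} (\<lambda>t. t powr (\<alpha> - \<beta> * \<phi> t)))}"

definition gamma_fun :: "nat \<Rightarrow> (real \<Rightarrow> real) \<Rightarrow> (nat \<Rightarrow> nat) \<Rightarrow> nat \<Rightarrow> nat" where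
  "gamma_fun d \<phi> N j = Max {k. real (N k) * 2 powr (real d * real k)
       \<le> 2 powr (- real d * real j * \<phi> ((1/2) ^ j)) * 2 powr (real d * real j)}"

definition dcube :: "nat \<Rightarrow> nat^'d \<Rightarrow> (real^'d) set" where
  "dcube j k = {y. \<forall>i. real (k$i) / 2^j \<le> y$i \<and> y$i \<le> (real (k$i) + 1) / 2^j}"

definition valid_corner :: "nat \<Rightarrow> nat^'d \<Rightarrow> bool" where
  "valid_corner j k \<longleftrightarrow> (\<forall>i. k$i < 2^j)"

definition prop_P :: "(nat \<Rightarrow> real^'d) \<Rightarrow> (nat \<Rightarrow> real) \<Rightarrow> (real \<Rightarrow> real) \<Rightarrow> (nat \<Rightarrow> nat)
     \<Rightarrow> nat \<Rightarrow> nat^'d \<Rightarrow> real \<Rightarrow> bool" where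
  "prop_P x r \<phi> N j k \<delta> \<longleftrightarrow>
     (\<exists>n. x n \<in> dcube j k \<and> (1/2) ^ (j+1) \<le> r n \<and> r n < (1/2) ^ j \<and>
        cball_inf (x n) (r n powr \<delta>) \<inter>
          {x p | p. real (gamma_fun CARD('d) \<phi> N j) \<le> - log 2 (r p) \<and>
                    - log 2 (r p) < real_of_int (\<lfloor>\<delta> * (real j + 1)\<rfloor>) + 4}
        = {x n})"

definition Q_set :: "(nat \<Rightarrow> real^'d) \<Rightarrow> (nat \<Rightarrow> real) \<Rightarrow> (real \<Rightarrow> real) \<Rightarrow> (nat \<Rightarrow> nat)
     \<Rightarrow> nat \<Rightarrow> nat^'d \<Rightarrow> nat \<Rightarrow> real \<Rightarrow> (nat^'d) set" where
  "Q_set x r \<phi> N g kU j \<delta> =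
     {k. valid_corner j k \<and> dcube j k \<subseteq> dcube g kU \<and> prop_P x r \<phi> N j k \<delta>}"

definition C2 :: "(nat \<Rightarrow> real^'d) \<Rightarrow> (nat \<Rightarrow> real) \<Rightarrow> bool" where
  "C2 x r \<longleftrightarrow> C1 x r \<and>
     (\<exists>\<phi> N (\<kappa> :: real \<Rightarrow> real) \<Delta>.
        \<phi> \<in> Phi_class \<and> C1_with x r N \<and>
        continuous_on {1<..} \<kappa> \<and> (\<forall>t>1. 0 < \<kappa> t \<and> \<kappa> t \<le> 1) \<and>
        \<Delta> \<subseteq> {1<..} \<and> {1<..} \<subseteq> closure \<Delta> \<and>
        (\<forall>\<delta>\<in>\<Delta>. \<forall>g kU. valid_corner g kU \<longrightarrow>
           infinite {j. g \<le> j \<and>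
              real (card (Q_set x r \<phi> N g kU j \<delta>))
                \<ge> \<kappa> \<delta> * 2 powr (real CARD('d) * (real j - real g))}))"

end

theory Submission
  imports Defs
begin

text \<open>
  Upper bound: if \<open>\<delta>\<^sub>y \<ge> m\<close>, then \<open>y\<close> lies, for every \<open>\<delta> < m\<close>, in infinitely many balls of radius
  \<open>r\<^sub>n\<^sup>\<delta>\<close> around points of the irreducible subsystem (or is itself one of the countably many
  \<open>x\<^sub>n\<close>), and \<open>C\<^sub>1\<close> makes the sum of the \<open>r\<^sub>n\<^sup>\<delta>\<^sup>s\<close> converge for \<open>s > d / \<delta>\<close>.

  Lower bound, near a point where \<open>1 < f < M\<close> and for \<open>s < d / M\<close>: instead of constructing a
  measure, one shows that sets \<open>A\<^sub>i\<close> of sizes \<open>t\<^sub>i\<close> with small sum of the \<open>t\<^sub>i\<^sup>s\<close> cannot cover.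
  A nested sequence of dyadic cubes is chosen greedily; the invariant on a cube of generation \<open>g\<close> is
  that the \<open>A\<^sub>i\<close> meeting it carry mass at most \<open>c 2\<^sup>-\<^sup>g\<^sup>s\<close>, which forces \<open>t\<^sub>i < 2\<^sup>-\<^sup>g\<close>. Condition
  \<open>C\<^sub>2\<close>, with \<open>\<delta>\<close> close to the value of \<open>f\<close> on the cube, offers a positive proportion of subcubes
  \<open>V\<close> of a large generation \<open>j\<close>. Only a smaller proportion is heavy or is approached too well by a point of
  scale between \<open>g\<close> and \<open>\<gamma>(j)\<close>, so a good \<open>V\<close> remains. The next cube lies in \<open>B(x(V), r(V)\<^sup>\<delta>)\<close> at
  distance comparable with \<open>r(V)\<^sup>\<delta>\<close> from both its centre and its boundary, so that property \<open>P\<close> excludes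
  better approximation at the scales from \<open>\<gamma>(j)\<close> to the generation of the new cube. Where \<open>f = 1\<close> on
  an open set, Lebesgue measure replaces the construction.
\<close>

section \<open>The sup distance\<close>

lemma linf_dist_le_iff: "linf_dist x y \<le> c \<longleftrightarrow> (\<forall>i. \<bar>x$i - y$i\<bar> \<le> c)"
  unfolding linf_dist_def by (subst Max_le_iff) auto

lemma component_le_linf_dist: "\<bar>x$i - y$i\<bar> \<le> linf_dist x y"
  using linf_dist_le_iff by blast

lemma linf_dist_nonneg: "0 \<le> linf_dist x y"
  by (meson abs_ge_zero component_le_linf_dist order_trans)

lemma linf_dist_commute: "linf_dist x y = linf_dist y x"
  unfolding linf_dist_def by (simp add: abs_minus_commute)

lemma linf_dist_triangle: "linf_dist x z \<le> linf_dist x y + linf_dist y z"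
  unfolding linf_dist_le_iff
proof
  fix i
  show "\<bar>x$i - z$i\<bar> \<le> linf_dist x y + linf_dist y z"
    using component_le_linf_dist[of x i y] component_le_linf_dist[of y i z] by linarith
qed

lemma linf_dist_eq_0_iff: "linf_dist x y = 0 \<longleftrightarrow> x = y"
proof
  assume "linf_dist x y = 0"
  then have "\<bar>x$i - y$i\<bar> \<le> 0" for i by (metis component_le_linf_dist)
  then show "x = y" by (simp add: vec_eq_iff)
next
  assume "x = y"
  then have "linf_dist x y \<le> 0" by (simp add: linf_dist_le_iff)
  then show "linf_dist x y = 0" using linf_dist_nonneg[of x y] by linarith
qed

lemma linf_dist_le_diam:
  assumes "bounded A" "p \<in> A" "q \<in> A"
  shows "linf_dist p q \<le> diam_inf A"
proof -
  obtain B where B: "\<And>a. a \<in> A \<Longrightarrow> norm a \<le> B" using assms(1) by (auto simp: bounded_iff)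
  have "bdd_above {linf_dist a b | a b. a \<in> A \<and> b \<in> A}"
  proof (rule bdd_aboveI)
    fix t assume "t \<in> {linf_dist a b | a b. a \<in> A \<and> b \<in> A}"
    then obtain a b where ab: "t = linf_dist a b" "a \<in> A" "b \<in> A" by blast
    have "\<bar>a$i - b$i\<bar> \<le> 2 * B" for i
      using component_le_norm_cart[of a i] component_le_norm_cart[of b i] B[OF ab(2)] B[OF ab(3)]
      by linarith
    then show "t \<le> 2 * B" by (simp add: ab(1) linf_dist_le_iff)
  qed
  then show ?thesis
    unfolding diam_inf_def using assms(2,3) by (auto intro!: cSup_upper)
qed

lemma diam_inf_nonneg: "bounded A \<Longrightarrow> 0 \<le> diam_inf A"
  using linf_dist_le_diam[of A] linf_dist_nonneg order_trans
  by (cases "A = {}") (simp_all add: diam_inf_def[of "{}"], blast)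

lemma diam_inf_le:
  assumes "0 \<le> t" "\<And>p q. p \<in> A \<Longrightarrow> q \<in> A \<Longrightarrow> linf_dist p q \<le> t"
  shows "diam_inf A \<le> t"
proof (cases "A = {}")
  case False
  then have "Sup {linf_dist a b | a b. a \<in> A \<and> b \<in> A} \<le> t"
    using assms(2) by (intro cSup_least) blast+
  then show ?thesis using False by (simp add: diam_inf_def)
qed (simp add: diam_inf_def assms(1))

lemma cball_inf_eq_cbox: "cball_inf x t = cbox (x - (\<chi> i. t)) (x + (\<chi> i. t))"
  by (auto simp: cball_inf_def linf_dist_le_iff mem_box_cart abs_le_iff algebra_simps)

lemma dist_in_cball_inf:
  assumes "p \<in> cball_inf x t" "q \<in> cball_inf x t"
  shows "linf_dist p q \<le> 2 * t"
  using linf_dist_triangle[of p q x] assms by (auto simp: cball_inf_def linf_dist_commute)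

section \<open>Hausdorff null sets\<close>

lemma term_le_suminf_ennreal: "f i \<le> (\<Sum>i. f i)" for f :: "nat \<Rightarrow> ennreal"
  using sum_le_suminf[OF summableI, of "{i}" f] by simp

lemma hausdorff_null_content:
  assumes "hausdorff_measure s E = 0" "0 < \<epsilon>" "0 < e"
  obtains U where "E \<subseteq> \<Union>(range U)" "\<And>i. bounded (U i)" "\<And>i. diam_inf (U i) \<le> \<epsilon>"
    "(\<Sum>i. ennreal (diam_inf (U i) powr s)) < ennreal e"
proof -
  have "hausdorff_content s \<epsilon> E \<le> hausdorff_measure s E"
    unfolding hausdorff_measure_def using assms(2) by (intro SUP_upper) auto
  then have "hausdorff_content s \<epsilon> E < ennreal e" using assms by simp
  then show ?thesis using that unfolding hausdorff_content_def INF_less_iff by auto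
qed

text \<open>For positive \<open>s\<close>, a small total of the powers \<open>diam powr s\<close>
  makes every single diameter small. So the mesh bound in the contents disappears, and nullity
  becomes a statement about bounded covers alone.\<close>

lemma hausdorff_measure_eq_0_iff:
  assumes "0 < s"
  shows "hausdorff_measure s E = 0 \<longleftrightarrow>
    (\<forall>e>0. \<exists>U. E \<subseteq> \<Union>(range U) \<and> (\<forall>i. bounded (U i)) \<and>
       (\<Sum>i. ennreal (diam_inf (U i) powr s)) < ennreal e)" (is "_ \<longleftrightarrow> ?R")
proof
  assume "hausdorff_measure s E = 0"
  then show ?R using hausdorff_null_content[of s E 1] by (metis zero_less_one)
next
  assume R: ?R
  have "hausdorff_content s \<epsilon> E \<le> ennreal e" if "0 < \<epsilon>" "0 < e" for \<epsilon> e
  proof -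
    \<comment> \<open>The term \<open>\<epsilon> powr s\<close> turns the bound on the sum into
      diameters below \<open>\<epsilon>\<close>.\<close>
    define e' where "e' = min e (\<epsilon> powr s)"
    have "e' > 0" using that by (simp add: e'_def)
    then obtain U where U: "E \<subseteq> \<Union>(range U)" "\<And>i. bounded (U i)"
      "(\<Sum>i. ennreal (diam_inf (U i) powr s)) < ennreal e'" using R by meson
    have "diam_inf (U i) \<le> \<epsilon>" for i
    proof -
      have "ennreal (diam_inf (U i) powr s) \<le> (\<Sum>i. ennreal (diam_inf (U i) powr s))"
        by (rule term_le_suminf_ennreal)
      then have "ennreal (diam_inf (U i) powr s) < ennreal e'" using U(3) by order
      then have "diam_inf (U i) powr s < \<epsilon> powr s" by (simp add: ennreal_less_iff e'_def)
      then show ?thesis using powr_mono2[of s \<epsilon> "diam_inf (U i)"] \<open>0 < \<epsilon>\<close> \<open>0 < s\<close> by fastforce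
    qed
    then have "hausdorff_content s \<epsilon> E \<le> (\<Sum>i. ennreal (diam_inf (U i) powr s))"
      unfolding hausdorff_content_def using U by (intro INF_lower) auto
    also have "\<dots> \<le> ennreal e'" using U(3) by simp
    also have "\<dots> \<le> ennreal e" by (simp add: e'_def ennreal_leI)
    finally show ?thesis .
  qed
  then have "hausdorff_content s \<epsilon> E = 0" if "0 < \<epsilon>" for \<epsilon>
    using that by (metis ennreal_le_epsilon ennreal_zero_neq_top le_zero_eq add_0)
  then show "hausdorff_measure s E = 0" unfolding hausdorff_measure_def by simp
qed

lemma hausdorff_null_subset:
  assumes "hausdorff_measure s E = 0" "F \<subseteq> E" "0 < s"
  shows "hausdorff_measure s F = 0"
  using assms(1) unfolding hausdorff_measure_eq_0_iff[OF \<open>0 < s\<close>]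
  using assms(2) by (meson order_trans)

text \<open>For diameters at most 1, raising the exponent lowers every term. The smaller exponent
  may be 0, as happens in \<open>hausdorff_dim_eqI\<close>.\<close>

lemma hausdorff_null_exponent_mono:
  assumes "hausdorff_measure s E = 0" "s \<le> s'" "0 < s'"
  shows "hausdorff_measure s' E = 0"
  unfolding hausdorff_measure_eq_0_iff[OF \<open>0 < s'\<close>]
proof (intro allI impI)
  fix e :: real assume "e > 0"
  obtain U where U: "E \<subseteq> \<Union>(range U)" "\<And>i. bounded (U i)" "\<And>i. diam_inf (U i) \<le> 1"
      "(\<Sum>i. ennreal (diam_inf (U i) powr s)) < ennreal e"
    using hausdorff_null_content[OF assms(1) zero_less_one \<open>e > 0\<close>] by metis
  have "diam_inf (U i) powr s' \<le> diam_inf (U i) powr s" for i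
    using U(2,3)[of i] diam_inf_nonneg[of "U i"] assms by (cases "diam_inf (U i) = 0") (auto intro: powr_mono')
  then have "(\<Sum>i. ennreal (diam_inf (U i) powr s')) \<le> (\<Sum>i. ennreal (diam_inf (U i) powr s))"
    by (intro suminf_le) (auto intro: ennreal_leI)
  then show "\<exists>U. E \<subseteq> \<Union>(range U) \<and> (\<forall>i. bounded (U i)) \<and>
      (\<Sum>i. ennreal (diam_inf (U i) powr s')) < ennreal e"
    using U by (meson order_le_less_trans)
qed

lemma hausdorff_null_Un:
  assumes "hausdorff_measure s E = 0" "hausdorff_measure s F = 0" "0 < s"
  shows "hausdorff_measure s (E \<union> F) = 0"
  unfolding hausdorff_measure_eq_0_iff[OF \<open>0 < s\<close>]
proof (intro allI impI)
  fix e :: real assume "e > 0"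
  then have e2: "e / 2 > 0" by simp
  obtain U where U: "E \<subseteq> \<Union>(range U)" "\<And>i. bounded (U i)"
      "(\<Sum>i. ennreal (diam_inf (U i) powr s)) < ennreal (e/2)"
    using assms(1) e2 unfolding hausdorff_measure_eq_0_iff[OF \<open>0 < s\<close>] by meson
  obtain V where V: "F \<subseteq> \<Union>(range V)" "\<And>i. bounded (V i)"
      "(\<Sum>i. ennreal (diam_inf (V i) powr s)) < ennreal (e/2)"
    using assms(2) e2 unfolding hausdorff_measure_eq_0_iff[OF \<open>0 < s\<close>] by meson
  \<comment> \<open>The two covers are interleaved, \<open>U\<close> at even and \<open>V\<close> at
    odd indices, so that the sum regroups into pairs.\<close>
  define W where "W n = (if even n then U (n div 2) else V (n div 2))" for n
  have "E \<union> F \<subseteq> \<Union>(range W)"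
  proof
    fix y assume "y \<in> E \<union> F"
    then obtain i where "y \<in> U i \<or> y \<in> V i" using U V by blast
    then have "y \<in> W (2 * i) \<or> y \<in> W (2 * i + 1)" by (auto simp: W_def)
    then show "y \<in> \<Union>(range W)" by blast
  qed
  moreover have "bounded (W n)" for n using U V by (simp add: W_def)
  moreover have "(\<Sum>i. ennreal (diam_inf (W i) powr s)) < ennreal e"
  proof -
    let ?u = "\<lambda>i. ennreal (diam_inf (U i) powr s)" and ?v = "\<lambda>i. ennreal (diam_inf (V i) powr s)"
    let ?w = "\<lambda>i. ennreal (diam_inf (W i) powr s)"
    have "?w (i*2) = ?u i" "?w (Suc (i*2)) = ?v i" for i by (simp_all add: W_def)
    moreover have "{i*2..<i*2+2} = {i*2, Suc (i*2)}" for i :: nat by auto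
    ultimately have grp: "(\<Sum>j=i*2..<i*2+2. ?w j) = ?u i + ?v i" for i by simp
    have "(\<Sum>i. \<Sum>j=i*2..<i*2+2. ?w j) = (\<Sum>i. ?w i)"
      by (rule sums_unique[OF sums_group, symmetric]) (auto intro: summable_sums)
    then have "(\<Sum>i. ?w i) = (\<Sum>i. \<Sum>j=i*2..<i*2+2. ?w j)" ..
    also have "\<dots> = (\<Sum>i. ?u i + ?v i)"
      by (simp only: grp)
    also have "\<dots> = (\<Sum>i. ?u i) + (\<Sum>i. ?v i)" by (simp add: suminf_add)
    also have "\<dots> < ennreal (e/2) + ennreal (e/2)" by (rule add_strict_mono[OF U(3) V(3)])
    also have "\<dots> = ennreal e" using \<open>e > 0\<close> by (simp flip: ennreal_plus)
    finally show ?thesis .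
  qed
  ultimately show "\<exists>U. E \<union> F \<subseteq> \<Union>(range U) \<and> (\<forall>i. bounded (U i)) \<and>
      (\<Sum>i. ennreal (diam_inf (U i) powr s)) < ennreal e" by blast
qed

lemma hausdorff_null_range:
  fixes x :: "nat \<Rightarrow> real^'d"
  assumes "0 < s" 
  shows "hausdorff_measure s (range x) = 0"
  unfolding hausdorff_measure_eq_0_iff[OF assms]
proof (intro allI impI exI conjI)
  fix e :: real assume "e > 0"
  show "range x \<subseteq> \<Union> (range (\<lambda>i. {x i}))" by auto
  have "diam_inf {x i} = 0" for i
    using diam_inf_le[of 0 "{x i}"] diam_inf_nonneg[of "{x i}"]
    by (metis antisym bounded_insert bounded_empty linf_dist_eq_0_iff order_refl singletonD)
  then show "(\<Sum>i. ennreal (diam_inf {x i} powr s)) < ennreal e" using assms \<open>e > 0\<close> by simp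
qed auto

text \<open>Replaces diameters by real sizes that are positive even for singletons. Positivity is
  what lets a cube of small enough side be compared with \<open>t i\<close> later.\<close>

lemma hausdorff_null_cover:
  assumes "hausdorff_measure s E = 0" "0 < s" "0 < e"
  obtains A :: "nat \<Rightarrow> (real^'d) set" and t :: "nat \<Rightarrow> real"
  where "E \<subseteq> \<Union>(range A)" "\<And>i. 0 < t i"
    "\<And>i p q. p \<in> A i \<Longrightarrow> q \<in> A i \<Longrightarrow> linf_dist p q \<le> t i"
    "summable (\<lambda>i. t i powr s)" "(\<Sum>i. t i powr s) < e"
proof -
  obtain U :: "nat \<Rightarrow> (real^'d) set" where U: "E \<subseteq> \<Union>(range U)" "\<And>i. bounded (U i)"
      "(\<Sum>i. ennreal (diam_inf (U i) powr s)) < ennreal (e/2)"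
    using assms unfolding hausdorff_measure_eq_0_iff[OF \<open>0 < s\<close>] by (meson half_gt_zero)
  let ?u = "\<lambda>i. diam_inf (U i) powr s"
  have finU: "(\<Sum>i. ennreal (?u i)) \<noteq> top" using U(3) by (metis ennreal_less_top less_trans order_less_irrefl)
  have su: "summable ?u" using finU by (intro summable_suminf_not_top) auto
  have su2: "(\<Sum>i. ?u i) < e / 2"
  proof -
    have "(\<Sum>i. ennreal (?u i)) = ennreal (\<Sum>i. ?u i)" by (rule suminf_ennreal2[OF _ su]) simp
    then have "ennreal (\<Sum>i. ?u i) < ennreal (e/2)" using U(3) by metis
    then show ?thesis using suminf_nonneg[OF su] by (subst (asm) ennreal_less_iff) auto
  qed
  \<comment> \<open>Each weight is raised by a geometric term of total \<open>e/2\<close>, while the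
    cover itself costs less than \<open>e/2\<close>. The root \<open>1/s\<close> then gives sizes
    with exactly these weights.\<close>
  define v where "v i = ?u i + e/4 * (1/2)^i" for i
  define t where "t i = v i powr (1/s)" for i
  have v0: "v i > 0" for i using assms(3) by (simp add: v_def add_nonneg_pos)
  have ts: "t i powr s = v i" for i using v0[of i] assms(2) by (simp add: t_def powr_powr)
  have gs: "(\<lambda>i. e/4 * (1/2)^i) sums (e/4 * 2)" using geometric_sums[of "1/2::real"] by (intro sums_mult) simp
  have vs: "v sums ((\<Sum>i. ?u i) + e/2)" unfolding v_def using sums_add[OF summable_sums[OF su] gs] by simp
  show ?thesis
  proof
    show "E \<subseteq> \<Union>(range U)" by fact
    show "0 < t i" for i using v0[of i] by (simp add: t_def)
    show "linf_dist p q \<le> t i" if "p \<in> U i" "q \<in> U i" for p q i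
    proof -
      have "linf_dist p q \<le> diam_inf (U i)" by (rule linf_dist_le_diam[OF U(2) that])
      also have "diam_inf (U i) = ?u i powr (1/s)" 
        using assms(2) diam_inf_nonneg[OF U(2)[of i]] by (simp add: powr_powr)
      also have "\<dots> \<le> t i" unfolding t_def v_def using assms by (intro powr_mono2) auto
      finally show ?thesis .
    qed
    show "summable (\<lambda>i. t i powr s)" unfolding ts using vs by (rule sums_summable)
    show "(\<Sum>i. t i powr s) < e" unfolding ts using sums_unique[OF vs] su2 by simp
  qed
qed

text \<open>A set of size \<open>t\<close> sits in a sup ball of volume \<open>(2 * t)^d\<close>,
  and \<open>t^d \<le> t powr s\<close> once \<open>t \<le> 1\<close> and
  \<open>s \<le> d\<close>.\<close>

lemma hausdorff_null_imp_negligible: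
  fixes E :: "(real^'d) set"
  assumes "hausdorff_measure s E = 0" "0 < s" "s \<le> real CARD('d)"
  shows "negligible E"
  unfolding negligible_outer_le
proof (intro allI impI)
  fix e :: real assume "e > 0"
  \<comment> \<open>The bound 1 forces all sizes to be at most 1; the divisor offsets the factor 2
    in the sides of the balls.\<close>
  define e' where "e' = min 1 (e / 2^CARD('d))"
  have "e' > 0" using \<open>e > 0\<close> by (simp add: e'_def)
  from hausdorff_null_cover[OF assms(1,2) this] obtain A :: "nat \<Rightarrow> (real^'d) set" and t
    where A: "E \<subseteq> \<Union>(range A)" "\<And>i. 0 < t i"
      "\<And>i p q. p \<in> A i \<Longrightarrow> q \<in> A i \<Longrightarrow> linf_dist p q \<le> t i"
      "summable (\<lambda>i. t i powr s)" "(\<Sum>i. t i powr s) < e'" by metis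
  \<comment> \<open>For empty \<open>A i\<close> the centre is arbitrary, and the inclusion still
    holds.\<close>
  define B where "B i = cball_inf (SOME p. p \<in> A i) (t i)" for i
  have AB: "A i \<subseteq> B i" for i
    using A(3) someI[of "\<lambda>p. p \<in> A i"] by (auto simp: B_def cball_inf_def)
  have lm: "B i \<in> lmeasurable" for i by (simp add: B_def cball_inf_eq_cbox)
  have t1: "t i \<le> 1" for i
  proof -
    have "t i powr s \<le> (\<Sum>i. t i powr s)" using sum_le_suminf[OF A(4), of "{i}"] by auto
    then have "t i powr s \<le> 1 powr s" using A(5) by (simp add: e'_def)
    then show ?thesis using powr_less_mono2[of s 1 "t i"] assms(2) by (meson not_less zero_le_one)
  qed
  have mB: "measure lebesgue (B i) \<le> 2^CARD('d) * t i powr s" for i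
  proof -
    have "measure lebesgue (B i) = (2 * t i) ^ CARD('d)"
      using A(2)[of i] unfolding B_def cball_inf_eq_cbox
      by (subst measure_completion, simp, subst content_cbox_cart)
        (auto simp: interval_eq_empty_cart not_less algebra_simps intro: less_imp_le)
    also have "\<dots> = 2^CARD('d) * t i powr real CARD('d)"
      using A(2)[of i] by (simp add: power_mult_distrib powr_realpow)
    also have "\<dots> \<le> 2^CARD('d) * t i powr s"
      using A(2)[of i] t1[of i] assms(3) by (intro mult_left_mono powr_mono') auto
    finally show ?thesis .
  qed
  have fs: "(\<Sum>i\<le>n. measure lebesgue (B i)) \<le> e" for n
  proof -
    have "(\<Sum>i\<le>n. measure lebesgue (B i)) \<le> (\<Sum>i\<le>n. 2^CARD('d) * t i powr s)"
      using mB by (intro sum_mono)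
    also have "\<dots> = 2^CARD('d) * (\<Sum>i\<le>n. t i powr s)" by (simp add: sum_distrib_left)
    also have "\<dots> \<le> 2^CARD('d) * (\<Sum>i. t i powr s)"
      using A(4) by (intro mult_left_mono sum_le_suminf) auto
    also have "\<dots> \<le> 2^CARD('d) * (e / 2^CARD('d))"
      using A(5) by (intro mult_left_mono) (auto simp: e'_def)
    finally show ?thesis by simp
  qed
  have sub: "measure lebesgue (\<Union>i\<le>n. B i) \<le> e" for n
    using measure_UNION_le[of "{..n}" B lebesgue] lm fs[of n] by (auto simp: fmeasurableD intro: order_trans)
  have "\<Union>(range B) \<in> lmeasurable" "measure lebesgue (\<Union>(range B)) \<le> e"
    using fmeasurable_countable_Union[OF lm sub] measure_countable_Union_le[OF lm sub] by auto
  then show "\<exists>T. E \<subseteq> T \<and> T \<in> lmeasurable \<and> measure lebesgue T \<le> e"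
    using A(1) AB by (meson UN_mono order_trans subset_refl SUP_mono')
qed

section \<open>Counting on dyadic grids\<close>

text \<open>In each coordinate an interval of length \<open>L\<close> holds at most
  \<open>L + 1\<close> integers. The encoding \<open>h\<close> makes one count serve both dyadic
  cubes, via their corners, and centres of the system, via grid cells.\<close>

lemma card_lattice_le:
  fixes h :: "'a \<Rightarrow> int^'d" and u :: "real^'d"
  assumes inj: "inj_on h S" and L: "0 \<le> L"
    and box: "\<And>a i. a \<in> S \<Longrightarrow> u$i \<le> real_of_int (h a $ i) \<and> real_of_int (h a $ i) \<le> u$i + L"
  shows "finite S" "real (card S) \<le> (L + 1) ^ CARD('d)"
proof -
  define T where "T i = {\<lceil>u$i\<rceil>..\<lfloor>u$i + L\<rfloor>}" for i
  have inj': "inj_on (\<lambda>a i. h a $ i) S"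
    using inj by (auto simp: inj_on_def vec_eq_iff fun_eq_iff)
  have sub: "(\<lambda>a i. h a $ i) ` S \<subseteq> Pi\<^sub>E UNIV T"
    using box by (auto simp: T_def ceiling_le_iff le_floor_iff)
  have fin: "finite (Pi\<^sub>E UNIV T)" by (intro finite_PiE) (auto simp: T_def)
  show "finite S" using finite_imageD[OF finite_subset[OF sub fin] inj'] .
  have "card S \<le> card (Pi\<^sub>E UNIV T)"
    using card_mono[OF fin sub] card_image[OF inj'] by simp
  also have "\<dots> = (\<Prod>i\<in>UNIV. card (T i))" by (simp add: card_PiE)
  finally have "real (card S) \<le> (\<Prod>i\<in>UNIV. real (card (T i)))" by (metis of_nat_le_iff of_nat_prod)
  also have "\<dots> \<le> (\<Prod>i\<in>(UNIV::'d set). L + 1)"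
  proof (intro prod_mono conjI)
    fix i
    have "real_of_int (\<lfloor>u$i + L\<rfloor> - \<lceil>u$i\<rceil> + 1) \<le> L + 1" by linarith
    then show "real (card (T i)) \<le> L + 1" using L by (simp add: T_def)
  qed simp
  finally show "real (card S) \<le> (L + 1) ^ CARD('d)" by simp
qed

text \<open>Splits a lattice count into a constant for the boundary effect and a multiple of the
  volume; the two parts are estimated differently later.\<close>

lemma power_add_le_max: "0 \<le> z \<Longrightarrow> (z + 2) ^ n \<le> 3 ^ n * (1 + z ^ n)" for z :: real
proof (cases "z \<le> 1")
  case True
  assume "0 \<le> z"
  then have "(z + 2) ^ n \<le> 3 ^ n * 1" using True by (simp add: power_mono)
  also have "\<dots> \<le> 3 ^ n * (1 + z ^ n)" using \<open>0 \<le> z\<close> by (intro mult_left_mono) auto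
  finally show ?thesis .
next
  case False
  then have "(z + 2) ^ n \<le> (3 * z) ^ n" by (intro power_mono) auto
  also have "\<dots> = 3 ^ n * z ^ n" by (rule power_mult_distrib)
  also have "\<dots> \<le> 3 ^ n * (1 + z ^ n)" by (intro mult_left_mono) auto
  finally show ?thesis .
qed

lemma card_dcubes_meeting:
  fixes A :: "(real^'d) set"
  assumes diam: "\<And>p q. p \<in> A \<Longrightarrow> q \<in> A \<Longrightarrow> linf_dist p q \<le> t" and t: "0 \<le> t"
  shows "finite {k. dcube j k \<inter> A \<noteq> {}}"
    "real (card {k. dcube j k \<inter> A \<noteq> {}}) \<le> 3 ^ CARD('d) * (1 + (2^j * t) ^ CARD('d))"
proof -
  let ?S = "{k. dcube j k \<inter> A \<noteq> {}}"
  have "finite ?S \<and> real (card ?S) \<le> 3 ^ CARD('d) * (1 + (2^j * t) ^ CARD('d))"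
  proof (cases "A = {}")
    case True
    then have "?S = {}" by auto
    then show ?thesis using t by (simp only: card.empty) auto
  next
    case False
    then obtain p0 where p0: "p0 \<in> A" by blast
    define u :: "real^'d" where "u = (\<chi> i. Inf ((\<lambda>p. p$i) ` A))"
    have bb: "bdd_below ((\<lambda>p. p$i) ` A)" for i
    proof (rule bdd_belowI2)
      fix p assume "p \<in> A"
      then show "p0$i - t \<le> p$i" using diam[OF p0, of p] component_le_linf_dist[of p0 i p] by linarith
    qed
    have u: "u$i \<le> p$i" "p$i \<le> u$i + t" if "p \<in> A" for p i
    proof -
      show "u$i \<le> p$i" unfolding u_def using that bb by (auto intro: cInf_lower)
      have "p$i - t \<le> Inf ((\<lambda>p. p$i) ` A)"
      proof (rule cInf_greatest)
        fix z assume "z \<in> (\<lambda>p. p$i) ` A"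
        then obtain q where "q \<in> A" "z = q$i" by blast
        then show "p$i - t \<le> z" using diam[OF that, of q] component_le_linf_dist[of p i q] by linarith
      qed (use p0 in auto)
      then show "p$i \<le> u$i + t" by (simp add: u_def)
    qed
    define h :: "nat^'d \<Rightarrow> int^'d" where "h k = (\<chi> i. int (k$i))" for k
    \<comment> \<open>A cube that meets \<open>A\<close> at \<open>p\<close> has its scaled corner
      between \<open>2^j * p$i - 1\<close> and \<open>2^j * p$i\<close>; hence the shift by 1 and
      the extra 1 in the side length.\<close>
    define v :: "real^'d" where "v = (\<chi> i. 2^j * u$i - 1)"
    have inj: "inj_on h ?S" by (auto simp: inj_on_def h_def vec_eq_iff)
    have box: "v$i \<le> real_of_int (h k$i) \<and> real_of_int (h k$i) \<le> v$i + (2^j * t + 1)" if "k \<in> ?S" for k i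
    proof -
      from that obtain p where p: "p \<in> A" "p \<in> dcube j k" by blast
      have "real (k$i) \<le> 2^j * p$i" "2^j * p$i \<le> real (k$i) + 1"
        using p(2) by (auto simp: dcube_def field_simps)
      moreover have "2^j * u$i \<le> 2^j * p$i" "2^j * p$i \<le> 2^j * (u$i + t)"
        using u[OF p(1), of i] by (simp_all only: mult_left_mono zero_le_power zero_le_numeral)
      ultimately show ?thesis unfolding h_def v_def vec_lambda_beta of_int_of_nat_eq distrib_left by linarith
    qed
    have L: "0 \<le> 2^j * t + 1" using t by simp
    have "finite ?S" by (rule card_lattice_le(1)[OF inj L box])
    moreover have "real (card ?S) \<le> (2^j * t + 1 + 1) ^ CARD('d)"
      by (rule card_lattice_le(2)[OF inj L box])
    ultimately show ?thesis using power_add_le_max[of "2^j * t" "CARD('d)"] t by (simp add: add.assoc)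
  qed
  then show "finite ?S" "real (card ?S) \<le> 3 ^ CARD('d) * (1 + (2^j * t) ^ CARD('d))" by auto
qed

text \<open>The midpoint of two centres in one grid cell of side \<open>2^-k\<close> is within
  \<open>2^-(k+1)\<close> of both, which is below both radii.\<close>

lemma T_idx_same_cell:
  assumes p: "p \<in> T_idx x r k" and q: "q \<in> T_idx x r k"
    and d: "\<And>i. \<lfloor>2^k * x p $ i\<rfloor> = \<lfloor>2^k * x q $ i\<rfloor>"
  shows "cball_inf (x p) (r p) \<inter> cball_inf (x q) (r q) \<noteq> {}"
proof -
  define m where "m = (1/2) *\<^sub>R (x p + x q)"
  have "\<bar>x p $ i - x q $ i\<bar> \<le> (1/2)^k" for i
  proof -
    have "\<bar>2^k * x p $ i - 2^k * x q $ i\<bar> \<le> 1" using d[of i] by linarith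
    then have "2^k * \<bar>x p $ i - x q $ i\<bar> \<le> 1" by (simp add: abs_mult flip: right_diff_distrib)
    then show ?thesis by (simp add: field_simps)
  qed
  then have "\<bar>x p $ i - m $ i\<bar> \<le> (1/2)^(k+1)" "\<bar>x q $ i - m $ i\<bar> \<le> (1/2)^(k+1)" for i
    by (auto simp: m_def abs_le_iff field_simps)
  then have "linf_dist (x p) m \<le> (1/2)^(k+1)" "linf_dist (x q) m \<le> (1/2)^(k+1)"
    unfolding linf_dist_le_iff by blast+
  moreover have "(1/2)^(k+1) < r p" "(1/2)^(k+1) < r q" using p q by (auto simp: T_idx_def)
  ultimately have "m \<in> cball_inf (x p) (r p) \<inter> cball_inf (x q) (r q)"
    unfolding cball_inf_def by force
  then show ?thesis by blast
qed

text \<open>Within one of the \<open>N k\<close> classes of \<open>C1\<close> the balls are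
  disjoint, so each grid cell of side \<open>2^-k\<close> contains at most one centre. It remains to
  count the cells that meet the box.\<close>

lemma card_T_idx_box:
  fixes x :: "nat \<Rightarrow> real^'d" and u :: "real^'d"
  assumes C1: "C1_with x r N" and k: "1 \<le> k" and P: "P \<subseteq> T_idx x r k" and L: "0 \<le> L"
    and box: "\<And>p i. p \<in> P \<Longrightarrow> u$i \<le> x p $ i \<and> x p $ i \<le> u$i + L"
  shows "finite P" "real (card P) \<le> real (N k) * (2^k * L + 2) ^ CARD('d)"
proof -
  have "\<forall>j\<ge>1. \<exists>c :: nat \<Rightarrow> nat. (\<forall>n \<in> T_idx x r j. c n < N j) \<and>
         (\<forall>n \<in> T_idx x r j. \<forall>m \<in> T_idx x r j. n \<noteq> m \<and> c n = c m \<longrightarrow>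
             cball_inf (x n) (r n) \<inter> cball_inf (x m) (r m) = {})"
    using C1 by (simp add: C1_with_def)
  from this[rule_format, OF k] obtain c :: "nat \<Rightarrow> nat" where c: "\<And>n. n \<in> T_idx x r k \<Longrightarrow> c n < N k"
    and disj: "\<And>n m. n \<in> T_idx x r k \<Longrightarrow> m \<in> T_idx x r k \<Longrightarrow> n \<noteq> m \<Longrightarrow> c n = c m \<Longrightarrow>
             cball_inf (x n) (r n) \<inter> cball_inf (x m) (r m) = {}" by blast
  define h :: "nat \<Rightarrow> int^'d" where "h p = (\<chi> i. \<lfloor>2^k * x p $ i\<rfloor>)" for p
  define v :: "real^'d" where "v = (\<chi> i. 2^k * u$i - 1)"
  define Q where "Q i = {p \<in> P. c p = i}" for i
  have Q: "finite (Q i) \<and> real (card (Q i)) \<le> (2^k * L + 2) ^ CARD('d)" for i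
  proof -
    have inj: "inj_on h (Q i)"
    proof (rule inj_onI, rule ccontr)
      fix p q assume pq: "p \<in> Q i" "q \<in> Q i" "h p = h q" "p \<noteq> q"
      then have T: "p \<in> T_idx x r k" "q \<in> T_idx x r k" and c: "c p = c q" using P by (auto simp: Q_def)
      have "cball_inf (x p) (r p) \<inter> cball_inf (x q) (r q) = {}"
        by (rule disj[OF T pq(4) c])
      moreover have "\<lfloor>2^k * x p $ i\<rfloor> = \<lfloor>2^k * x q $ i\<rfloor>" for i
        using pq(3) by (simp add: h_def vec_eq_iff)
      then have "cball_inf (x p) (r p) \<inter> cball_inf (x q) (r q) \<noteq> {}"
        by (rule T_idx_same_cell[OF T])
      ultimately show False by blast
    qed
    have box': "v$l \<le> real_of_int (h p $ l) \<and> real_of_int (h p $ l) \<le> v$l + (2^k * L + 1)"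
      if "p \<in> Q i" for p l
    proof -
      have "u$l \<le> x p $ l" "x p $ l \<le> u$l + L" using box that by (auto simp: Q_def)
      then have "2^k * u$l \<le> 2^k * x p $ l" "2^k * x p $ l \<le> 2^k * (u$l + L)"
        by (simp_all only: mult_left_mono zero_le_power zero_le_numeral)
      moreover have "2^k * x p $ l - 1 \<le> real_of_int \<lfloor>2^k * x p $ l\<rfloor>"
        "real_of_int \<lfloor>2^k * x p $ l\<rfloor> \<le> 2^k * x p $ l" by linarith+
      ultimately show ?thesis unfolding h_def v_def vec_lambda_beta distrib_left by linarith
    qed
    have L': "0 \<le> 2^k * L + 1" using L by simp
    show ?thesis using card_lattice_le(1)[OF inj L' box'] card_lattice_le(2)[OF inj L' box']
      by (simp add: add.assoc)
  qed
  have PU: "P = (\<Union>i<N k. Q i)" using c P by (auto simp: Q_def)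
  show "finite P" unfolding PU using Q by auto
  have "card P \<le> (\<Sum>i<N k. card (Q i))" unfolding PU by (rule card_UN_le) simp
  then have "real (card P) \<le> (\<Sum>i<N k. real (card (Q i)))" by (metis of_nat_le_iff of_nat_sum)
  also have "\<dots> \<le> (\<Sum>i<N k. (2^k * L + 2) ^ CARD('d))" using Q by (intro sum_mono) blast
  finally show "real (card P) \<le> real (N k) * (2^k * L + 2) ^ CARD('d)" by simp
qed

section \<open>Geometry of dyadic cubes\<close>

lemma dcube_eq_cbox: "dcube j k = cbox (\<chi> i. real (k$i) / 2^j) (\<chi> i. (real (k$i) + 1) / 2^j)"
  by (auto simp: dcube_def mem_box_cart)

lemma compact_dcube: "compact (dcube j k)"
  by (simp add: dcube_eq_cbox)

lemma corner_in_dcube: "(\<chi> i. real (k$i) / 2^j) \<in> dcube j k"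
  by (auto simp: dcube_def field_simps)

lemma dist_in_dcube:
  assumes "p \<in> dcube j k" "q \<in> dcube j k"
  shows "linf_dist p q \<le> (1/2)^j"
  unfolding linf_dist_le_iff
proof
  fix i
  have "real (k$i) / 2^j \<le> p$i" "p$i \<le> (real (k$i) + 1) / 2^j"
    "real (k$i) / 2^j \<le> q$i" "q$i \<le> (real (k$i) + 1) / 2^j" using assms by (auto simp: dcube_def)
  then have "\<bar>p$i - q$i\<bar> \<le> 1 / 2^j" unfolding add_divide_distrib by linarith
  then show "\<bar>p$i - q$i\<bar> \<le> (1/2)^j" by (simp add: power_one_over)
qed

lemma dcube_containing:
  fixes y :: "real^'d"
  assumes "\<And>i. 0 \<le> y$i" "\<And>i. y$i < 1"
  obtains k where "valid_corner j k" "y \<in> dcube j k"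
proof
  let ?k = "\<chi> i. nat \<lfloor>2^j * y$i\<rfloor>"
  have f: "real (nat \<lfloor>2^j * y$i\<rfloor>) = real_of_int \<lfloor>2^j * y$i\<rfloor>" for i using assms(1)[of i] by simp
  have "2^j * y$i < 2^j" for i using assms(2)[of i] by simp
  then have "real (nat \<lfloor>2^j * y$i\<rfloor>) < 2^j" for i unfolding f by (meson floor_le_iff le_less_trans of_int_floor_le)
  then show "valid_corner j ?k" by (simp add: valid_corner_def)
  have "real (nat \<lfloor>2^j * y$i\<rfloor>) \<le> 2^j * y$i \<and> 2^j * y$i \<le> real (nat \<lfloor>2^j * y$i\<rfloor>) + 1" for i
    unfolding f by linarith
  then show "y \<in> dcube j ?k" by (simp add: dcube_def field_simps)
qed

text \<open>Links sup balls to the Euclidean topology: the norm is at most the sum of the absolute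
  coordinates, hence the factor \<open>CARD('d)\<close>.\<close>

lemma open_contains_cball_inf:
  fixes W :: "(real^'d) set"
  assumes "open W" "y \<in> W"
  obtains e where "0 < e" "cball_inf y e \<subseteq> W"
proof -
  obtain e where e: "0 < e" "cball y e \<subseteq> W" using assms open_contains_cball by blast
  have "cball_inf y (e / CARD('d)) \<subseteq> cball y e"
  proof
    fix z assume "z \<in> cball_inf y (e / CARD('d))"
    then have "\<bar>(y - z)$i\<bar> \<le> e / CARD('d)" for i by (simp add: cball_inf_def linf_dist_le_iff)
    then have "(\<Sum>i\<in>UNIV. \<bar>(y - z)$i\<bar>) \<le> (\<Sum>i\<in>(UNIV::'d set). e / CARD('d))" by (intro sum_mono)
    then have "norm (y - z) \<le> e" using norm_le_l1_cart[of "y - z"] by simp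
    then show "z \<in> cball y e" by (simp add: dist_norm)
  qed
  with e show ?thesis by (intro that[of "e / CARD('d)"]) auto
qed

text \<open>The bound \<open>g0\<close> lets the construction start at a generation beyond which the
  tail of a convergent series is small.\<close>

lemma open_contains_dcube:
  fixes W :: "(real^'d) set"
  assumes "open W" "W \<noteq> {}" "W \<subseteq> open_unit_cube"
  obtains g k where "g0 \<le> g" "valid_corner g k" "dcube g k \<subseteq> W"
proof -
  obtain y where y: "y \<in> W" using assms by blast
  obtain e where e: "0 < e" "cball_inf y e \<subseteq> W" using open_contains_cball_inf[OF assms(1) y] .
  obtain n where n: "(1/2::real)^n < e" using real_arch_pow_inv[OF e(1), of "1/2"] by auto
  have yi: "0 \<le> y$i" "y$i < 1" for i using y assms(3) by (auto simp: open_unit_cube_def intro: less_imp_le)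
  obtain k where k: "valid_corner (max n g0) k" "y \<in> dcube (max n g0) k"
    using dcube_containing[of y, OF yi] .
  have "(1/2::real)^(max n g0) \<le> (1/2)^n" by (intro power_decreasing) auto
  then have "(1/2::real)^(max n g0) \<le> e" using n by linarith
  then have "dcube (max n g0) k \<subseteq> cball_inf y e"
    using dist_in_dcube[OF k(2)] by (auto simp: cball_inf_def intro: order_trans)
  with e k show ?thesis by (intro that[of "max n g0" k]) auto
qed

lemma dcube_subset_unit_cube: "valid_corner j k \<Longrightarrow> dcube j k \<subseteq> closed_unit_cube"
proof (rule subsetI)
  fix y assume v: "valid_corner j k" and y: "y \<in> dcube j k"
  have "0 \<le> y$i \<and> y$i \<le> 1" for i
  proof -
    have "real (k$i) / 2^j \<le> y$i" "y$i \<le> (real (k$i) + 1) / 2^j" using y by (auto simp: dcube_def)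
    moreover have "k$i + 1 \<le> 2^j" using v by (simp add: valid_corner_def Suc_leI)
    then have "real (k$i + 1) \<le> real (2^j)" by (simp only: of_nat_le_iff)
    then have "real (k$i) + 1 \<le> 2^j" by simp
    then have "(real (k$i) + 1) / 2^j \<le> 1" by simp
    moreover have "0 \<le> real (k$i) / 2^j" by simp
    ultimately show ?thesis by linarith
  qed
  then show "y \<in> closed_unit_cube" by (simp add: closed_unit_cube_def)
qed

section \<open>The upper bound\<close>

lemma half_power_eq_powr: "(1/2)^j = (2::real) powr (- real j)"
  by (simp add: powr_minus_divide powr_realpow power_divide)

lemma dyadic_level:
  fixes \<rho> :: real
  assumes "0 < \<rho>" "\<rho> \<le> (1/2)^g"
  obtains k where "g \<le> k" "(1/2)^(k+1) < \<rho>" "\<rho> \<le> (1/2)^k"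
proof -
  obtain n where n: "(1/2::real)^n < \<rho>" using real_arch_pow_inv[OF assms(1), of "1/2"] by auto
  have "(1/2::real)^(n+1) \<le> (1/2)^n" by (intro power_decreasing) auto
  then have ex: "(1/2)^(n+1) < \<rho>" using n by linarith
  define k where "k = (LEAST k. (1/2)^(k+1) < \<rho>)"
  have k: "(1/2)^(k+1) < \<rho>" unfolding k_def by (rule LeastI[of "\<lambda>k. (1/2)^(k+1) < \<rho>", OF ex])
  have "g \<le> k"
  proof (rule ccontr)
    assume "\<not> g \<le> k"
    then have "(1/2::real)^g \<le> (1/2)^(k+1)" by (intro power_decreasing) auto
    then show False using k assms(2) by linarith
  qed
  moreover have "\<rho> \<le> (1/2)^k"
  proof (cases k)
    case 0
    then show ?thesis using assms(2) \<open>g \<le> k\<close> by simp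
  next
    case (Suc l)
    then have "\<not> (1/2)^(l+1) < \<rho>" using not_less_Least[of l "\<lambda>k. (1/2)^(k+1) < \<rho>"] unfolding k_def by simp
    then show ?thesis using Suc by simp
  qed
  ultimately show ?thesis using k that by blast
qed

lemma C1_with_subexponential:
  assumes "C1_with x r N" "0 < \<eta>"
  shows "\<forall>\<^sub>F k in sequentially. real (N k) \<le> 2 powr (\<eta> * real k)"
proof -
  have "(\<lambda>j. log 2 (real (N j)) / real j) \<longlonglongrightarrow> 0" and pos: "\<And>j. 0 < N j"
    using assms(1) by (auto simp: C1_with_def)
  then have "\<forall>\<^sub>F j in sequentially. log 2 (real (N j)) / real j < \<eta>"
    using assms(2) by (intro order_tendstoD)
  moreover have "\<forall>\<^sub>F j::nat in sequentially. 0 < j" by (rule eventually_gt_at_top)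
  ultimately show ?thesis
  proof eventually_elim
    case (elim j)
    then have "log 2 (real (N j)) \<le> \<eta> * real j" by (simp add: field_simps)
    then show ?case using pos[of j] by (simp add: log_le_iff)
  qed
qed

lemma C1_with_summable:
  assumes "C1_with x r N" "0 < \<sigma>" "\<sigma> < 1"
  shows "summable (\<lambda>k. real (N k) * \<sigma>^k)"
proof -
  \<comment> \<open>Half the decay rate of \<open>\<sigma>\<close>: the growth of \<open>N k\<close>
    uses up one half, and the other half leaves a convergent geometric series.\<close>
  define \<eta> where "\<eta> = - log 2 \<sigma> / 2"
  have "log 2 \<sigma> < 0" using assms by simp
  then have \<eta>: "0 < \<eta>" by (simp add: \<eta>_def)
  have \<sigma>: "\<sigma> = 2 powr (- 2 * \<eta>)" using assms by (simp add: \<eta>_def)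
  have "summable (\<lambda>k. (2 powr (- \<eta>)) ^ k)" using \<eta> by (intro summable_geometric) (simp add: powr_less_one)
  moreover have "\<forall>\<^sub>F k in sequentially. norm (real (N k) * \<sigma>^k) \<le> (2 powr (- \<eta>)) ^ k"
    using C1_with_subexponential[OF assms(1) \<eta>]
  proof eventually_elim
    case (elim k)
    have "real (N k) * \<sigma>^k \<le> 2 powr (\<eta> * real k) * \<sigma>^k" using elim assms by (intro mult_right_mono) auto
    also have "\<dots> = (2 powr (- \<eta>)) ^ k"
      by (simp add: \<sigma> powr_power powr_add[symmetric] algebra_simps)
    finally show ?case using assms by simp
  qed
  ultimately show ?thesis by (rule summable_comparison_test_ev[rotated])
qed

text \<open>\<open>C1\<close> controls only first occurrences of centres, whereas
  \<open>L_set\<close> counts all indices. Passing to the first occurrence does not shrink the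
  radius, so the inequality survives. If only finitely many first occurrences arose, one centre
  would recur with radii tending to 0 and would equal \<open>y\<close>.\<close>

lemma infinite_irred_idx:
  assumes sys: "is_system x r" and y: "y \<notin> range x" and \<delta>: "0 < \<delta>"
    and inf: "infinite {n. linf_dist y (x n) \<le> r n powr \<delta>}"
  shows "infinite {n \<in> irred_idx x. linf_dist y (x n) \<le> r n powr \<delta>}" (is "infinite ?F")
proof
  assume fin: "finite ?F"
  let ?I = "{n. linf_dist y (x n) \<le> r n powr \<delta>}"
  define \<pi> where "\<pi> n = (LEAST p. x p = x n)" for n
  have x\<pi>: "x (\<pi> n) = x n" for n unfolding \<pi>_def by (rule LeastI) simp
  have le: "\<pi> n \<le> n" for n unfolding \<pi>_def by (rule Least_le) simp
  have "\<pi> ` ?I \<subseteq> ?F"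
  proof clarify
    fix n assume n: "linf_dist y (x n) \<le> r n powr \<delta>"
    have "r n \<le> r (\<pi> n)" "0 < r n" using sys le[of n] by (auto simp: is_system_def decseq_def)
    then have "r n powr \<delta> \<le> r (\<pi> n) powr \<delta>" using \<delta> by (intro powr_mono2) auto
    then show "\<pi> n \<in> irred_idx x \<and> linf_dist y (x (\<pi> n)) \<le> r (\<pi> n) powr \<delta>"
      using n x\<pi>[of n] by (auto simp: irred_idx_def \<pi>_def)
  qed
  then have "finite (\<pi> ` ?I)" using fin finite_subset by blast
  then have "\<exists>n0\<in>?I. infinite {n \<in> ?I. \<pi> n = \<pi> n0}"
    by (rule pigeonhole_infinite[OF inf])
  then obtain n0 where n0: "infinite {n \<in> ?I. \<pi> n = \<pi> n0}" by blast
  have "linf_dist y (x n0) \<le> \<epsilon>" if "0 < \<epsilon>" for \<epsilon>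
  proof -
    have "r \<longlonglongrightarrow> 0" "\<And>n. 0 < r n" using sys by (auto simp: is_system_def)
    then have "(\<lambda>n. r n powr \<delta>) \<longlonglongrightarrow> 0" using \<delta> by (auto intro!: tendsto_eq_intros always_eventually intro: less_imp_le)
    then have "\<forall>\<^sub>F n in sequentially. r n powr \<delta> < \<epsilon>" using that by (intro order_tendstoD)
    then obtain m where m: "\<And>n. n \<ge> m \<Longrightarrow> r n powr \<delta> < \<epsilon>" by (auto simp: eventually_sequentially)
    obtain n where n: "n > m" "n \<in> {n \<in> ?I. \<pi> n = \<pi> n0}"
      using n0 unfolding infinite_nat_iff_unbounded by blast
    then have "x n = x n0" using x\<pi>[of n] x\<pi>[of n0] by simp
    then show ?thesis using n m[of n] by auto
  qed
  then have "linf_dist y (x n0) \<le> 0" by (rule field_le_epsilon) simp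
  then have "y = x n0" using linf_dist_nonneg[of y "x n0"] linf_dist_eq_0_iff by force
  then show False using y by blast
qed

text \<open>Level \<open>j\<close> has at most \<open>N j * (3 * 2^j)^d\<close> centres, each of
  weight at most a constant times \<open>2 powr (- j * \<delta> * s)\<close>. The levels are thus
  dominated by the terms \<open>N j * \<sigma>^j\<close> with \<open>\<sigma> < 1\<close>.\<close>

lemma summable_irred_idx:
  fixes x :: "nat \<Rightarrow> real^'d"
  assumes sys: "is_system x r" and C1: "C1_with x r N"
    and \<delta>: "0 < \<delta>" and s: "real CARD('d) < \<delta> * s"
  shows "summable (\<lambda>n. if n \<in> irred_idx x then (2 * r n powr \<delta>) powr s else 0)" (is "summable ?w")
proof -
  have rpos: "0 < r n" for n using sys by (simp add: is_system_def)
  have "0 < \<delta> * s" using s by (rule le_less_trans[rotated]) simp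
  then have s0: "0 < s" using \<delta> by (simp add: zero_less_mult_iff)
  have "r \<longlonglongrightarrow> 0" using sys by (simp add: is_system_def)
  then have "\<forall>\<^sub>F n in sequentially. r n < 1/2" by (intro order_tendstoD) auto
  then obtain n0 where n0: "\<And>n. n \<ge> n0 \<Longrightarrow> r n \<le> 1/2"
    unfolding eventually_sequentially by (meson less_imp_le)
  \<comment> \<open>Radii at most 1/2 have a level at least 1, the range in which \<open>C1\<close>
    provides a decomposition.\<close>
  define lev where "lev n = (SOME k. 1 \<le> k \<and> (1/2)^(k+1) < r n \<and> r n \<le> (1/2)^k)" for n
  have lev: "1 \<le> lev n" "(1/2)^(lev n+1) < r n" "r n \<le> (1/2)^(lev n)" if "n \<ge> n0" for n
  proof -
    have "r n \<le> (1/2)^1" using n0[OF that] by simp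
    then obtain k where "1 \<le> k \<and> (1/2)^(k+1) < r n \<and> r n \<le> (1/2)^k"
      using dyadic_level[OF rpos[of n]] by metis
    from someI[of "\<lambda>k. 1 \<le> k \<and> (1/2)^(k+1) < r n \<and> r n \<le> (1/2)^k", OF this]
    show "1 \<le> lev n" "(1/2)^(lev n+1) < r n" "r n \<le> (1/2)^(lev n)" unfolding lev_def by blast+
  qed
  define \<sigma> where "\<sigma> = 2 powr (real CARD('d) - \<delta> * s)"
  have \<sigma>: "0 < \<sigma>" "\<sigma> < 1" using s by (auto simp: \<sigma>_def powr_less_one)
  have sm: "summable (\<lambda>k. real (N k) * \<sigma>^k)" by (rule C1_with_summable[OF C1 \<sigma>])
  define K where "K = 3 ^ CARD('d) * 2 powr s"
  have "summable (\<lambda>i. ?w (i + n0))"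
  proof (rule summableI_nonneg_bounded)
    fix m
    define F where "F = {n \<in> {n0..<n0+m}. n \<in> irred_idx x}"
    have finF: "finite F" by (simp add: F_def)
    have "(\<Sum>i<m. ?w (i + n0)) = sum ?w {n0..<n0+m}"
      using sum.shift_bounds_nat_ivl[of ?w 0 n0 m] by (simp add: atLeast0LessThan add.commute)
    also have "\<dots> = (\<Sum>n\<in>F. (2 * r n powr \<delta>) powr s)"
      unfolding F_def by (intro sum.inter_filter[symmetric]) simp
    also have "\<dots> = (\<Sum>j\<in>lev ` F. \<Sum>n\<in>{n \<in> F. lev n = j}. (2 * r n powr \<delta>) powr s)"
      using finF by (intro sum.group[symmetric]) auto
    also have "\<dots> \<le> (\<Sum>j\<in>lev ` F. K * (real (N j) * \<sigma>^j))"
    proof (rule sum_mono)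
      fix j assume "j \<in> lev ` F"
      then have j1: "1 \<le> j" using lev(1) by (auto simp: F_def)
      let ?P = "{n \<in> F. lev n = j}"
      have PT: "?P \<subseteq> T_idx x r j" using lev(2,3) by (auto simp: F_def T_idx_def)
      have "real (card ?P) \<le> real (N j) * (2^j * 1 + 2) ^ CARD('d)"
        using sys by (intro card_T_idx_box(2)[OF C1 j1 PT, where u=0])
          (auto simp: is_system_def closed_unit_cube_def)
      also have "\<dots> \<le> real (N j) * (3 * 2^j) ^ CARD('d)"
        using one_le_power[of "2::real" j] by (intro mult_left_mono power_mono) auto
      finally have cP: "real (card ?P) \<le> real (N j) * (3 * 2^j) ^ CARD('d)" .
      have "(\<Sum>n\<in>?P. (2 * r n powr \<delta>) powr s) \<le> (\<Sum>n\<in>?P. (2 * (2 powr (- real j)) powr \<delta>) powr s)"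
      proof (rule sum_mono)
        fix n assume "n \<in> ?P"
        then have "r n \<le> (1/2)^j" using lev(3) by (auto simp: F_def)
        also have "(1/2)^j = 2 powr (- real j)" by (simp only: half_power_eq_powr)
        finally show "(2 * r n powr \<delta>) powr s \<le> (2 * (2 powr (- real j)) powr \<delta>) powr s"
          using rpos[of n] \<delta> s0 by (intro powr_mono2 mult_left_mono) auto
      qed
      also have "\<dots> = real (card ?P) * (2 powr s * 2 powr (- (\<delta> * s * real j)))"
        by (simp add: powr_mult powr_powr algebra_simps)
      also have "\<dots> \<le> (real (N j) * (3 * 2^j) ^ CARD('d)) * (2 powr s * 2 powr (- (\<delta> * s * real j)))"
        using cP by (intro mult_right_mono) auto
      also have "\<dots> = K * (real (N j) * ((2^j) ^ CARD('d) * 2 powr (- (\<delta> * s * real j))))"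
        by (simp add: K_def power_mult_distrib mult_ac)
      also have "(2^j) ^ CARD('d) * 2 powr (- (\<delta> * s * real j)) = \<sigma>^j"
        by (simp add: \<sigma>_def powr_power powr_realpow[symmetric] powr_powr powr_add[symmetric] algebra_simps
            flip: power_mult)
      finally show "(\<Sum>n\<in>?P. (2 * r n powr \<delta>) powr s) \<le> K * (real (N j) * \<sigma>^j)" .
    qed
    also have "\<dots> = K * (\<Sum>j\<in>lev ` F. real (N j) * \<sigma>^j)" by (simp add: sum_distrib_left)
    also have "\<dots> \<le> K * (\<Sum>j. real (N j) * \<sigma>^j)"
      using finF \<sigma> sm by (intro mult_left_mono sum_le_suminf) (auto simp: K_def)
    finally show "(\<Sum>i<m. ?w (i + n0)) \<le> K * (\<Sum>j. real (N j) * \<sigma>^j)" .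
  qed auto
  then show ?thesis by (rule summable_iff_shift[THEN iffD1])
qed

text \<open>A Borel-Cantelli argument: the balls of any tail of the irreducible subsystem cover the
  limsup set, and their total weight tends to 0. The points of the system, to which the reduction
  does not apply, form a countable null set.\<close>

lemma hausdorff_null_L_set:
  fixes x :: "nat \<Rightarrow> real^'d"
  assumes sys: "is_system x r" and C1: "C1 x r"
    and \<delta>: "0 < \<delta>" and s: "real CARD('d) < \<delta> * s"
  shows "hausdorff_measure s (L_set x r \<delta>) = 0"
proof -
  obtain N where N: "C1_with x r N" using C1 by (auto simp: C1_def)
  have "0 < \<delta> * s" using s by (rule le_less_trans[rotated]) simp
  then have s0: "0 < s" using \<delta> by (simp add: zero_less_mult_iff)
  let ?w = "\<lambda>n. if n \<in> irred_idx x then (2 * r n powr \<delta>) powr s else 0"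
  define L where "L = {y. infinite {n \<in> irred_idx x. linf_dist y (x n) \<le> r n powr \<delta>}}"
  note sm = summable_irred_idx[OF sys N \<delta> s]
  have "hausdorff_measure s L = 0"
    unfolding hausdorff_measure_eq_0_iff[OF s0]
  proof (intro allI impI)
    fix e :: real assume "e > 0"
    obtain m where m: "norm (\<Sum>i. ?w (i + m)) < e" using suminf_exist_split[OF \<open>e > 0\<close> sm] by blast
    \<comment> \<open>Indices outside the irreducible subsystem get the empty set, whose
      \<open>diam_inf\<close> is 0.\<close>
    define U where "U i = (if i + m \<in> irred_idx x then cball_inf (x (i+m)) (r (i+m) powr \<delta>) else {})" for i
    have "L \<subseteq> \<Union>(range U)"
    proof
      fix y assume "y \<in> L"
      then obtain n where n: "n > m" "n \<in> irred_idx x" "linf_dist y (x n) \<le> r n powr \<delta>"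
        unfolding L_def infinite_nat_iff_unbounded by blast
      then have "y \<in> U (n - m)" by (simp add: U_def cball_inf_def linf_dist_commute)
      then show "y \<in> \<Union>(range U)" by blast
    qed
    moreover have bd: "bounded (U i)" for i
      by (simp add: U_def cball_inf_eq_cbox bounded_cbox)
    moreover have "(\<Sum>i. ennreal (diam_inf (U i) powr s)) < ennreal e"
    proof -
      have le: "diam_inf (U i) powr s \<le> ?w (i + m)" for i
      proof (cases "i + m \<in> irred_idx x")
        case True
        have "diam_inf (U i) \<le> 2 * r (i + m) powr \<delta>"
          using True dist_in_cball_inf by (intro diam_inf_le) (auto simp: U_def)
        then show ?thesis using True diam_inf_nonneg[OF bd[of i]] s0 by (simp add: powr_mono2)
      next
        case False
        then show ?thesis by (simp add: U_def diam_inf_def)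
      qed
      have sm': "summable (\<lambda>i. ?w (i + m))" using summable_ignore_initial_segment[OF sm] .
      have "(\<Sum>i. ennreal (diam_inf (U i) powr s)) \<le> (\<Sum>i. ennreal (?w (i + m)))"
        using le by (intro suminf_le ennreal_leI summableI)
      also have "\<dots> = ennreal (\<Sum>i. ?w (i + m))" using sm' by (intro suminf_ennreal2) auto
      also have "\<dots> < ennreal e" using m \<open>e > 0\<close> by (intro ennreal_lessI) auto
      finally show ?thesis .
    qed
    ultimately show "\<exists>U. L \<subseteq> \<Union>(range U) \<and> (\<forall>i. bounded (U i)) \<and>
       (\<Sum>i. ennreal (diam_inf (U i) powr s)) < ennreal e" by blast
  qed
  then have "hausdorff_measure s (L \<union> range x) = 0"
    using hausdorff_null_range[OF s0] hausdorff_null_Un s0 by blast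
  moreover have "L_set x r \<delta> \<subseteq> L \<union> range x"
    using infinite_irred_idx[OF sys _ \<delta>] by (auto simp: L_def L_set_def)
  ultimately show ?thesis using hausdorff_null_subset s0 by blast
qed

section \<open>The function gamma\<close>

text \<open>As \<phi> tends to 0 and \<open>N\<close> is subexponential, \<gamma>(j) stays within a
  factor \<open>1 + \<epsilon>\<close> of \<open>j\<close>. As \<open>t powr (- \<phi> t)\<close>
  tends to infinity, the bound for the number of points at scale \<gamma>(j) is a vanishing share of
  the number of cubes of generation \<open>j\<close>.\<close>

lemma gamma_fun_eventually:
  assumes phi: "\<phi> \<in> Phi_class" and C1: "C1_with x r N" and \<epsilon>: "0 < \<epsilon>" and d: "1 \<le> d"
  shows "\<forall>\<^sub>F j in sequentially. real j + 3 \<le> (1 + \<epsilon>) * real (gamma_fun d \<phi> N j) \<and>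
    real (N (gamma_fun d \<phi> N j)) * 2 ^ (d * gamma_fun d \<phi> N j) \<le> \<epsilon> * 2 ^ (d * j)"
proof -
  define K where "K j = {k. real (N k) * 2 powr (real d * real k)
       \<le> 2 powr (- real d * real j * \<phi> ((1/2) ^ j)) * 2 powr (real d * real j)}" for j
  have \<gamma>: "gamma_fun d \<phi> N j = Max (K j)" for j by (simp add: gamma_fun_def K_def)
  have \<phi>0: "0 \<le> \<phi> t" if "0 \<le> t" for t using phi that by (auto simp: Phi_class_def)
  have N1: "1 \<le> real (N k)" for k using C1 by (simp add: C1_with_def Suc_leI)
  \<comment> \<open>Since \<open>N k \<ge> 1\<close> and \<phi> is nonnegative, candidates are at
    most \<open>j\<close>, so \<open>Max\<close> is taken over a finite set.\<close>
  have Kle: "K j \<subseteq> {..j}" for j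
  proof
    fix k assume "k \<in> K j"
    then have k: "real (N k) * 2 powr (real d * real k)
       \<le> 2 powr (- real d * real j * \<phi> ((1/2) ^ j)) * 2 powr (real d * real j)" by (simp add: K_def)
    have "1 * 2 powr (real d * real k) \<le> real (N k) * 2 powr (real d * real k)"
      using N1 by (intro mult_right_mono) auto
    also note k
    also have "2 powr (- real d * real j * \<phi> ((1/2) ^ j)) * 2 powr (real d * real j)
        \<le> 1 * 2 powr (real d * real j)"
    proof (rule mult_right_mono)
      have "2 powr (- real d * real j * \<phi> ((1/2) ^ j)) \<le> 2 powr 0"
        using \<phi>0 by (intro powr_mono) auto
      then show "2 powr (- real d * real j * \<phi> ((1/2) ^ j)) \<le> 1" by simp
    qed simp
    finally have "real d * real k \<le> real d * real j" by simp
    then show "k \<in> {..j}" using d by simp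
  qed
  then have finK: "finite (K j)" for j by (rule finite_subset) simp
  have "continuous_on {0..} \<phi>" "\<phi> 0 = 0" using phi by (auto simp: Phi_class_def)
  moreover have half: "(\<lambda>j. (1/2::real)^j) \<longlonglongrightarrow> 0" by (rule LIMSEQ_realpow_zero) auto
  ultimately have \<phi>lim: "(\<lambda>j. \<phi> ((1/2)^j)) \<longlonglongrightarrow> 0"
    using continuous_on_tendsto_compose[of "{0..}" \<phi> "\<lambda>j. (1/2)^j" 0] by simp
  \<comment> \<open>Chosen so that \<open>(1 + \<eta>) / (1 - \<eta>) < 1 + \<epsilon>\<close>: one
    \<open>\<eta>\<close> is lost to the growth of \<open>N\<close>, the other to \<phi>.\<close>
  define \<eta> where "\<eta> = \<epsilon> / (3 + \<epsilon>)"
  have \<eta>: "0 < \<eta>" using \<epsilon> by (simp add: \<eta>_def)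
  have \<eta>': "(1 + \<eta>) < (1 - \<eta>) * (1 + \<epsilon>)" using \<epsilon> by (simp add: \<eta>_def field_simps add_pos_pos)
  obtain k0 where k0: "\<And>k. k \<ge> k0 \<Longrightarrow> real (N k) \<le> 2 powr (\<eta> * real k)"
    using C1_with_subexponential[OF C1 \<eta>] by (auto simp: eventually_sequentially)
  \<comment> \<open>The least integer with \<open>(1 + \<epsilon>) * k \<ge> j + 3\<close>. Once it
    is a candidate for the maximum, the first claim follows.\<close>
  define k where "k j = nat \<lceil>(real j + 3) / (1 + \<epsilon>)\<rceil>" for j
  have k1: "(real j + 3) / (1 + \<epsilon>) \<le> real (k j)" for j unfolding k_def by linarith
  have k2: "real (k j) \<le> (real j + 3) / (1 + \<epsilon>) + 1" for j
    using \<epsilon> unfolding k_def by (simp add: of_nat_nat)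
  have e1: "\<forall>\<^sub>F j in sequentially. \<phi> ((1/2)^j) \<le> \<eta>"
    using order_tendstoD(2)[OF \<phi>lim \<eta>] by eventually_elim simp
  have e2: "\<forall>\<^sub>F j::nat in sequentially. real k0 * (1 + \<epsilon>) \<le> real j"
    by (rule eventually_sequentiallyI[of "nat \<lceil>real k0 * (1 + \<epsilon>)\<rceil>"]) linarith
  define D where "D = (1 - \<eta>) * (1 + \<epsilon>) - (1 + \<eta>)"
  have D: "0 < D" using \<eta>' by (simp add: D_def)
  have e3: "\<forall>\<^sub>F j::nat in sequentially. (4 + \<epsilon>) * (1 + \<eta>) / D \<le> real j"
    by (rule eventually_sequentiallyI[of "nat \<lceil>(4 + \<epsilon>) * (1 + \<eta>) / D\<rceil>"]) linarith
  have "filterlim (\<lambda>j. (1/2::real)^j) (at_right 0) sequentially"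
    using half by (auto simp: filterlim_at)
  moreover have "filterlim (\<lambda>t. t powr (- \<phi> t)) at_top (at_right 0)" using phi by (simp add: Phi_class_def)
  ultimately have "filterlim (\<lambda>j. ((1/2)^j) powr (- \<phi> ((1/2)^j))) at_top sequentially"
    by (rule filterlim_compose[rotated])
  then have e4: "\<forall>\<^sub>F j in sequentially. max 1 (1/\<epsilon>) \<le> ((1/2)^j) powr (- \<phi> ((1/2)^j))"
    unfolding filterlim_at_top by blast
  from e1 e2 e3 e4 show ?thesis
  proof eventually_elim
    case (elim j)
    have "real k0 \<le> (real j + 3) / (1 + \<epsilon>)" using elim(2) \<epsilon> by (simp add: field_simps)
    then have "k0 \<le> k j" using k1[of j] by simp
    then have Nk: "real (N (k j)) \<le> 2 powr (\<eta> * real (k j))" by (rule k0)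
    have "(1 + \<eta>) * real (k j) \<le> (1 + \<eta>) * ((real j + 3) / (1 + \<epsilon>) + 1)"
      using k2[of j] \<eta> by (intro mult_left_mono) auto
    also have "\<dots> = (1 + \<eta>) * (real j + 4 + \<epsilon>) / (1 + \<epsilon>)" using \<epsilon> by (simp add: field_simps)
    also have "\<dots> \<le> (1 - \<eta>) * (1 + \<epsilon>) * real j / (1 + \<epsilon>)"
    proof (rule divide_right_mono)
      have "(4 + \<epsilon>) * (1 + \<eta>) \<le> D * real j" using elim(3) D by (simp add: field_simps)
      then show "(1 + \<eta>) * (real j + 4 + \<epsilon>) \<le> (1 - \<eta>) * (1 + \<epsilon>) * real j"
        unfolding D_def by (simp add: algebra_simps)
    qed (use \<epsilon> in simp)
    also have "\<dots> = (1 - \<eta>) * real j" using \<epsilon> by simp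
    finally have kj: "(1 + \<eta>) * real (k j) \<le> (1 - \<eta>) * real j" .
    have "real (N (k j)) * 2 powr (real d * real (k j)) \<le> 2 powr (\<eta> * real (k j)) * 2 powr (real d * real (k j))"
      using Nk by (intro mult_right_mono) auto
    also have "\<dots> = 2 powr (\<eta> * real (k j) + real d * real (k j))" by (simp add: powr_add)
    also have "\<dots> \<le> 2 powr (- real d * real j * \<phi> ((1/2) ^ j) + real d * real j)"
    proof (rule powr_mono)
      have "1 * (\<eta> * real (k j)) \<le> real d * (\<eta> * real (k j))" using d \<eta> by (intro mult_right_mono) auto
      then have "\<eta> * real (k j) + real d * real (k j) \<le> real d * ((1 + \<eta>) * real (k j))"
        by (simp add: algebra_simps)
      also have "\<dots> \<le> real d * ((1 - \<eta>) * real j)" using kj by (intro mult_left_mono) auto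
      also have "\<dots> \<le> real d * ((1 - \<phi> ((1/2) ^ j)) * real j)"
        using elim(1) by (intro mult_left_mono mult_right_mono) auto
      finally show "\<eta> * real (k j) + real d * real (k j) \<le> - real d * real j * \<phi> ((1/2) ^ j) + real d * real j"
        by (simp add: algebra_simps)
    qed simp
    also note powr_add
    finally have kK: "k j \<in> K j" unfolding K_def by (rule CollectI)
    have "k j \<le> Max (K j)" using kK finK by (intro Max_ge)
    then have "(real j + 3) / (1 + \<epsilon>) \<le> real (Max (K j))" using k1[of j] by (meson of_nat_le_iff order_trans)
    then have c1: "real j + 3 \<le> (1 + \<epsilon>) * real (Max (K j))" using \<epsilon> by (simp add: field_simps)
    define m where "m = Max (K j)"
    have "m \<in> K j" using kK finK unfolding m_def by (intro Max_in) auto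
    then have m: "real (N m) * 2 powr (real d * real m)
       \<le> 2 powr (- real d * real j * \<phi> ((1/2) ^ j)) * 2 powr (real d * real j)" by (simp add: K_def)
    \<comment> \<open>The value of \<open>t powr (- \<phi> t)\<close> at \<open>t = 2^-j\<close>.
      The factor in the definition of \<gamma> is \<open>Z powr (- d)\<close>, hence at most
      \<open>1 / Z\<close>.\<close>
    define Z where "Z = ((1/2)^j) powr (- \<phi> ((1/2)^j))"
    have Z: "1 \<le> Z" "1/\<epsilon> \<le> Z" using elim(4) by (auto simp: Z_def)
    have Zeq: "Z = 2 powr (real j * \<phi> ((1/2)^j))" unfolding Z_def half_power_eq_powr by (simp add: powr_powr)
    have "2 powr (- real d * real j * \<phi> ((1/2) ^ j)) = Z powr (- real d)"
      by (simp add: Zeq powr_powr mult_ac)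
    also have "\<dots> \<le> Z powr (- 1)" using Z d by (intro powr_mono) auto
    also have "\<dots> = 1 / Z" using Z by (simp add: powr_minus_divide)
    also have "\<dots> \<le> \<epsilon>" using Z \<epsilon> by (simp add: field_simps)
    finally have "real (N m) * 2 powr (real d * real m) \<le> \<epsilon> * 2 powr (real d * real j)"
      using m by (meson mult_right_mono order_trans powr_ge_zero)
    moreover have "2 powr (real d * real i) = 2 ^ (d * i)" for i :: nat
      by (metis of_nat_mult powr_realpow zero_less_numeral)
    ultimately show ?case using c1 unfolding \<gamma> m_def by simp
  qed
qed

section \<open>Bad cubes\<close>

text \<open>Stands in for a measure but is not additive: a set that spans many cubes is counted
  fully in each of them. Heavy cubes must therefore be counted geometrically.\<close>

definition cover_mass :: "(nat \<Rightarrow> 'a set) \<Rightarrow> (nat \<Rightarrow> real) \<Rightarrow> real \<Rightarrow> 'a set \<Rightarrow> real" where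
  "cover_mass A t s W = (\<Sum>i. if A i \<inter> W \<noteq> {} then t i powr s else 0)"

lemma cover_mass_summable:
  fixes t :: "nat \<Rightarrow> real"
  shows "summable (\<lambda>i. t i powr s) \<Longrightarrow> summable (\<lambda>i. if A i \<inter> W \<noteq> {} then t i powr s else 0)"
  by (rule summable_comparison_test'[where N=0 and g="\<lambda>i. t i powr s"]) auto

lemma cover_mass_term:
  assumes "summable (\<lambda>i. t i powr s)" "A i \<inter> W \<noteq> {}"
  shows "t i powr s \<le> cover_mass A t s W"
  using sum_le_suminf[OF cover_mass_summable[OF assms(1), of A W], of "{i}"] assms(2)
  by (simp add: cover_mass_def)

lemma cover_mass_mono:
  assumes "summable (\<lambda>i. t i powr s)" "V \<subseteq> W"
  shows "cover_mass A t s V \<le> cover_mass A t s W"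
  unfolding cover_mass_def
  using assms by (intro suminf_le cover_mass_summable) auto

text \<open>
  A set \<open>A i\<close> much larger than \<open>2 powr - G\<close> makes every cube that it meets heavy, whatever its
  mass, so counting with the full weights \<open>t i powr s\<close> would be too lossy: each \<open>A i\<close> is
  counted with its weight relative to the threshold, truncated at 1.
\<close>

lemma card_heavy_dcubes:
  fixes A :: "nat \<Rightarrow> (real^'d) set" and W :: "(real^'d) set"
  assumes tpos: "\<And>i. 0 < t i"
    and diam: "\<And>i p q. p \<in> A i \<Longrightarrow> q \<in> A i \<Longrightarrow> linf_dist p q \<le> t i"
    and sm: "summable (\<lambda>i. t i powr s)"
    and s: "0 < s" "s \<le> real CARD('d)" and c: "0 < c" "c \<le> 1"
    and W: "cover_mass A t s W \<le> c * 2 powr (- real g * s)"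
    and F: "finite F" "\<And>k. k \<in> F \<Longrightarrow> dcube j k \<subseteq> W"
      "\<And>k. k \<in> F \<Longrightarrow> c * 2 powr (- G * s) < cover_mass A t s (dcube j k)"
  shows "real (card F) \<le> 3^CARD('d) * (2 powr ((G - real g) * s) + c * (2^j / 2^g)^CARD('d))"
proof -
  let ?d = "CARD('d)"
  \<comment> \<open>The weight relative to the threshold \<open>c * 2 powr (- G * s)\<close> above
    which a cube is heavy.\<close>
  define a where "a i = t i powr s * (2 powr (G * s) / c)" for i
  have a0: "0 \<le> a i" for i using c by (simp add: a_def)
  have tle: "t i \<le> (1/2)^g" if "A i \<inter> W \<noteq> {}" for i
  proof -
    have "t i powr s \<le> c * 2 powr (- real g * s)" 
      using cover_mass_term[where t=t and s=s and A=A and i=i, OF sm that] W by linarith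
    also have "\<dots> \<le> 1 * 2 powr (- real g * s)" using c by (intro mult_right_mono) auto
    also have "\<dots> = ((1/2)^g) powr s" unfolding half_power_eq_powr by (simp add: powr_powr)
    finally show ?thesis using powr_less_mono2[of s "(1/2)^g" "t i"] s by (meson not_le zero_le_power zero_le_divide_1_iff zero_le_numeral)
  qed
  define b where "b i = (if A i \<inter> W \<noteq> {} then min 1 (a i) else 0)" for i
  have b0: "0 \<le> b i" for i using a0 by (simp add: b_def)
  have sma: "summable a" unfolding a_def using sm by (rule summable_mult2)
  have smb: "summable (\<lambda>i. if A i \<inter> V \<noteq> {} then b i else 0)" for V
    using a0 b0 by (intro summable_comparison_test'[OF sma, where N=0]) (auto simp: b_def)
  \<comment> \<open>Either some set meeting the cube has relative weight at least 1, and its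
    truncated weight alone is 1, or nothing is truncated and heaviness gives a relative sum of at
    least 1.\<close>
  have one: "1 \<le> (\<Sum>i. if A i \<inter> dcube j k \<noteq> {} then b i else 0)" if k: "k \<in> F" for k
  proof (cases "\<exists>i. A i \<inter> dcube j k \<noteq> {} \<and> 1 \<le> a i")
    case True
    then obtain i where i: "A i \<inter> dcube j k \<noteq> {}" "1 \<le> a i" by blast
    then have "A i \<inter> W \<noteq> {}" using F(2)[OF k] by blast
    then have "b i = 1" using i by (simp add: b_def)
    then show ?thesis using sum_le_suminf[OF smb[of "dcube j k"], of "{i}"] b0 i(1) by simp
  next
    case False
    have "(if A i \<inter> dcube j k \<noteq> {} then b i else 0)
        = (if A i \<inter> dcube j k \<noteq> {} then t i powr s else 0) * (2 powr (G * s) / c)" for i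
    proof (cases "A i \<inter> dcube j k \<noteq> {}")
      case True
      then have "A i \<inter> W \<noteq> {}" using F(2)[OF k] by blast
      moreover have "a i < 1" using False True by force
      ultimately show ?thesis using True by (simp add: b_def a_def)
    qed simp
    then have "(\<Sum>i. if A i \<inter> dcube j k \<noteq> {} then b i else 0)
        = cover_mass A t s (dcube j k) * (2 powr (G * s) / c)"
      unfolding cover_mass_def
      by (simp only: suminf_mult2[OF cover_mass_summable[OF sm], symmetric])
    moreover have "c * 2 powr (- G * s) * (2 powr (G * s) / c)
        \<le> cover_mass A t s (dcube j k) * (2 powr (G * s) / c)"
      using F(3)[OF k] c by (intro mult_right_mono) auto
    moreover have "c * 2 powr (- G * s) * (2 powr (G * s) / c) = 1"
      using c by (simp add: powr_minus)
    ultimately show ?thesis by linarith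
  qed
  \<comment> \<open>Bounds the contribution of \<open>A i\<close> over all cubes. One summand comes
    from the constant in \<open>card_dcubes_meeting\<close>, the other from its volume part, where
    \<open>t i \<le> 2^-g\<close> reduces \<open>t^d\<close> to \<open>t powr s\<close>.\<close>
  define T where "T i = 3^?d * ((if A i \<inter> W \<noteq> {} then t i powr s else 0) *
      (2 powr (G * s) / c + (2^j)^?d * ((1/2)^g) powr (real ?d - s)))" for i
  have smT: "summable T" unfolding T_def
    by (intro summable_mult summable_mult2 cover_mass_summable sm)
  have "real (card F) = (\<Sum>k\<in>F. 1)" by simp
  also have "\<dots> \<le> (\<Sum>k\<in>F. \<Sum>i. if A i \<inter> dcube j k \<noteq> {} then b i else 0)"
    by (intro sum_mono one)
  also have "\<dots> = (\<Sum>i. \<Sum>k\<in>F. if A i \<inter> dcube j k \<noteq> {} then b i else 0)"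
    by (rule suminf_sum[symmetric]) (rule smb)
  also have "\<dots> \<le> (\<Sum>i. T i)"
  proof (rule suminf_le[OF _ _ smT])
    show "summable (\<lambda>i. \<Sum>k\<in>F. if A i \<inter> dcube j k \<noteq> {} then b i else 0)"
      by (rule summable_sum) (rule smb)
    fix i
    show "(\<Sum>k\<in>F. if A i \<inter> dcube j k \<noteq> {} then b i else 0) \<le> T i"
    proof (cases "A i \<inter> W \<noteq> {}")
      case True
      have cd: "finite {k. dcube j k \<inter> A i \<noteq> {}}"
        "real (card {k. dcube j k \<inter> A i \<noteq> {}}) \<le> 3^?d * (1 + (2^j * t i)^?d)"
        by (rule card_dcubes_meeting[OF _ less_imp_le[OF tpos]], rule diam, assumption, assumption)+
      have "(\<Sum>k\<in>F. if A i \<inter> dcube j k \<noteq> {} then b i else 0) = real (card {k\<in>F. A i \<inter> dcube j k \<noteq> {}}) * b i"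
        using F(1) by (simp add: sum.inter_filter[symmetric])
      also have "\<dots> \<le> 3^?d * (1 + (2^j * t i)^?d) * b i"
      proof (rule mult_right_mono[OF _ b0])
        have "card {k\<in>F. A i \<inter> dcube j k \<noteq> {}} \<le> card {k. dcube j k \<inter> A i \<noteq> {}}"
          using cd(1) by (intro card_mono) auto
        then show "real (card {k\<in>F. A i \<inter> dcube j k \<noteq> {}}) \<le> 3^?d * (1 + (2^j * t i)^?d)"
          using cd(2) by linarith
      qed
      also have "\<dots> = 3^?d * (b i + (2^j * t i)^?d * b i)" by (simp add: algebra_simps)
      \<comment> \<open>The truncated weight is at most \<open>a i\<close>, used in the constant
        part, and at most 1, used in the volume part.\<close>
      also have "\<dots> \<le> 3^?d * (a i + (2^j * t i)^?d * 1)"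
        using tpos[of i] True by (intro mult_left_mono add_mono) (auto simp: b_def less_imp_le)
      also have "\<dots> \<le> 3^?d * (t i powr s * (2 powr (G * s) / c) + (2^j)^?d * (t i powr s * ((1/2)^g) powr (real ?d - s)))"
      proof (intro mult_left_mono add_mono)
        have "t i ^ ?d = t i powr s * t i powr (real ?d - s)"
          using tpos[of i] by (simp add: powr_realpow flip: powr_add)
        also have "\<dots> \<le> t i powr s * ((1/2)^g) powr (real ?d - s)"
          using tle[OF True] tpos[of i] s by (intro mult_left_mono powr_mono2) auto
        finally show "(2^j * t i)^?d * 1 \<le> (2^j)^?d * (t i powr s * ((1/2)^g) powr (real ?d - s))"
          by (simp add: power_mult_distrib)
      qed (simp_all add: a_def)
      also have "\<dots> = T i" using True by (simp add: T_def algebra_simps)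
      finally show ?thesis .
    next
      case False
      then have "A i \<inter> dcube j k = {}" if "k \<in> F" for k using F(2)[OF that] by blast
      then have "(\<Sum>k\<in>F. if A i \<inter> dcube j k \<noteq> {} then b i else 0) = 0" by (intro sum.neutral) auto
      then show ?thesis using False by (simp add: T_def)
    qed
  qed
  also have "\<dots> = 3^?d * (cover_mass A t s W * (2 powr (G * s) / c + (2^j)^?d * ((1/2)^g) powr (real ?d - s)))"
    unfolding T_def cover_mass_def
    using cover_mass_summable[OF sm, of A W] by (simp only: suminf_mult suminf_mult2 summable_mult2)
  also have "\<dots> \<le> 3^?d * (c * 2 powr (- real g * s) * (2 powr (G * s) / c + (2^j)^?d * ((1/2)^g) powr (real ?d - s)))"
    using W c by (intro mult_left_mono mult_right_mono) auto
  also have "\<dots> = 3^?d * (2 powr ((G - real g) * s) + c * (2^j / 2^g)^?d)"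
  proof -
    have "c * 2 powr (- real g * s) * (2 powr (G * s) / c) = 2 powr ((G - real g) * s)"
      using c by (simp add: algebra_simps flip: powr_add)
    moreover have "2 powr (- real g * s) * ((1/2)^g) powr (real ?d - s) = 1 / (2^g)^?d"
    proof -
      have "2 powr (- real g * s) * ((1/2)^g) powr (real ?d - s) = 2 powr (- (real g * real ?d))"
        unfolding half_power_eq_powr by (simp add: powr_powr algebra_simps flip: powr_add)
      also have "\<dots> = 1 / 2 ^ (g * ?d)"
        by (metis of_nat_mult powr_minus_divide powr_realpow zero_less_numeral)
      finally show ?thesis by (simp add: power_mult)
    qed
    then have "c * 2 powr (- real g * s) * ((2^j)^?d * ((1/2)^g) powr (real ?d - s)) = c * (2^j / 2^g)^?d"
      by (simp add: power_divide mult_ac)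
    ultimately show ?thesis by (simp add: distrib_left)
  qed
  finally show ?thesis .
qed

section \<open>Cubes approached too well by points of the system\<close>

lemma sum_powers_le_power: "1 \<le> d \<Longrightarrow> (\<Sum>k<n. (2::real) ^ (d * k)) \<le> 2 ^ (d * n)"
proof (induction n)
  case (Suc n)
  have "2 * (2::real) ^ (d * n) \<le> 2 ^ d * 2 ^ (d * n)"
    using Suc.prems power_increasing[of 1 d "2::real"] by (intro mult_right_mono) auto
  also have "\<dots> = 2 ^ (d * Suc n)" by (simp add: power_add)
  finally show ?case using Suc.IH[OF Suc.prems] unfolding sum.lessThan_Suc by linarith
qed simp

text \<open>Level \<open>k\<close> has at most \<open>N k * (5 * 2^k / 2^g)^d\<close> centres near
  the large cube, and each reaches a number of subcubes bounded by a constant part and a volume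
  part. The constant parts sum geometrically to the first term; the volume parts give a series with
  ratio below 1 up to the factor \<open>N k\<close>, because \<open>a > 1\<close>.\<close>

lemma card_dcubes_near_system:
  fixes x :: "nat \<Rightarrow> real^'d"
  assumes sys: "is_system x r" and C1: "C1_with x r N" and g: "1 \<le> g" and a: "1 < a"
    and F: "\<And>l. l \<in> F \<Longrightarrow> dcube j l \<subseteq> dcube g kU"
      "\<And>l. l \<in> F \<Longrightarrow> \<exists>k p y. g \<le> k \<and> k < n \<and> p \<in> T_idx x r k \<and> y \<in> dcube j l \<and>
                linf_dist y (x p) \<le> r p powr a"
  shows "real (card F) \<le> 15^CARD('d) * (real (N n) * 2^(CARD('d) * n) / 2^(CARD('d) * g))
    + 30^CARD('d) * (2^j / 2^g)^CARD('d) * (\<Sum>k\<in>{g..<n}. real (N k) * ((2 powr (1 - a))^CARD('d))^k)"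
proof -
  let ?d = "CARD('d)"
  have rpos: "0 < r p" for p using sys by (simp add: is_system_def)
  define P where "P k = {p \<in> T_idx x r k. \<exists>y\<in>dcube g kU. linf_dist y (x p) \<le> r p powr a}" for k
  define B where "B p = {l. dcube j l \<inter> cball_inf (x p) (r p powr a) \<noteq> {}}" for p
  have P: "finite (P k)" "real (card (P k)) \<le> real (N k) * (5 * 2^k / 2^g) ^ ?d" if k: "g \<le> k" for k
  proof -
    have k1: "1 \<le> k" using g k by simp
    have PT: "P k \<subseteq> T_idx x r k" by (auto simp: P_def)
    have L: "(0::real) \<le> 3 / 2^g" by simp
    \<comment> \<open>By \<open>a > 1\<close> and \<open>r p \<le> 2^-g \<le> 1\<close> the centre
      is within \<open>2^-g\<close> of the cube, hence in the concentric box of three times its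
      side.\<close>
    have box: "(\<chi> i. (real (kU$i) - 1) / 2^g)$i \<le> x p $ i \<and> x p $ i \<le> (\<chi> i. (real (kU$i) - 1) / 2^g)$i + 3 / 2^g"
      if "p \<in> P k" for p i
    proof -
      have "\<exists>y\<in>dcube g kU. linf_dist y (x p) \<le> r p powr a" using that by (simp add: P_def)
      then obtain y where y: "y \<in> dcube g kU" "linf_dist y (x p) \<le> r p powr a" by blast
      have rp: "r p \<le> (1/2)^k" using that by (auto simp: P_def T_idx_def)
      also have "\<dots> \<le> (1/2)^g" using k by (intro power_decreasing) auto
      finally have rg: "r p \<le> 1 / 2^g" by (simp add: power_one_over)
      also have "\<dots> \<le> 1" by simp
      finally have "r p powr a \<le> r p powr 1" using rpos[of p] a by (intro powr_mono') auto
      then have "\<bar>y$i - x p $ i\<bar> \<le> 1 / 2^g"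
        using y(2) rg rpos[of p] component_le_linf_dist[of y i "x p"] by simp
      moreover have "real (kU$i) / 2^g \<le> y$i" "y$i \<le> (real (kU$i) + 1) / 2^g" using y(1) by (auto simp: dcube_def)
      ultimately show ?thesis
        unfolding vec_lambda_beta add_divide_distrib diff_divide_distrib by linarith
    qed
    show "finite (P k)" by (rule card_T_idx_box(1)[OF C1 k1 PT L box])
    have "real (card (P k)) \<le> real (N k) * (2^k * (3 / 2^g) + 2) ^ ?d"
      by (rule card_T_idx_box(2)[OF C1 k1 PT L box])
    also have "\<dots> \<le> real (N k) * (5 * 2^k / 2^g) ^ ?d"
    proof (intro mult_left_mono power_mono)
      have "(2::real)^g \<le> 2^k" using k by (intro power_increasing) auto
      then show "2^k * (3 / 2^g) + 2 \<le> 5 * 2^k / (2::real)^g" by (simp add: field_simps)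
    qed auto
    finally show "real (card (P k)) \<le> real (N k) * (5 * 2^k / 2^g) ^ ?d" .
  qed
  define w where "w k = 3^?d * (1 + (2^j * (2 * ((1/2)^k) powr a)) ^ ?d)" for k
  have B: "finite (B p)" "real (card (B p)) \<le> w k" if "p \<in> P k" for p k
  proof -
    have nn: "0 \<le> 2 * (r p powr a)" by simp
    show "finite (B p)" unfolding B_def
      by (rule card_dcubes_meeting(1)[OF _ nn]) (rule dist_in_cball_inf)
    have "real (card (B p)) \<le> 3^?d * (1 + (2^j * (2 * (r p powr a))) ^ ?d)" unfolding B_def
      by (rule card_dcubes_meeting(2)[OF _ nn]) (rule dist_in_cball_inf)
    also have "\<dots> \<le> w k" unfolding w_def
      using that rpos[of p] a
      by (intro mult_left_mono add_left_mono power_mono powr_mono2) (auto simp: P_def T_idx_def)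
    finally show "real (card (B p)) \<le> w k" .
  qed
  have sub: "F \<subseteq> (\<Union>k\<in>{g..<n}. \<Union>p\<in>P k. B p)"
  proof
    fix l assume l: "l \<in> F"
    obtain k p y where h: "g \<le> k" "k < n" "p \<in> T_idx x r k" "y \<in> dcube j l" "linf_dist y (x p) \<le> r p powr a"
      using F(2)[OF l] by blast
    have "y \<in> dcube g kU" using F(1)[OF l] h(4) by blast
    then have "p \<in> P k" using h(3,5) by (auto simp: P_def)
    moreover have "l \<in> B p" using h(4,5) by (auto simp: B_def cball_inf_def linf_dist_commute)
    ultimately show "l \<in> (\<Union>k\<in>{g..<n}. \<Union>p\<in>P k. B p)" using h(1,2) by auto
  qed
  define \<rho> where "\<rho> = (2 powr (1 - a))^?d"
  have fin: "finite (\<Union>k\<in>{g..<n}. \<Union>p\<in>P k. B p)" using P(1) B(1) by auto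
  have "card F \<le> card (\<Union>k\<in>{g..<n}. \<Union>p\<in>P k. B p)" by (rule card_mono[OF fin sub])
  also have "\<dots> \<le> (\<Sum>k\<in>{g..<n}. card (\<Union>p\<in>P k. B p))" by (rule card_UN_le) simp
  also have "\<dots> \<le> (\<Sum>k\<in>{g..<n}. \<Sum>p\<in>P k. card (B p))"
    using P(1) by (intro sum_mono card_UN_le) auto
  finally have "real (card F) \<le> real (\<Sum>k\<in>{g..<n}. \<Sum>p\<in>P k. card (B p))" by (simp only: of_nat_le_iff)
  then have "real (card F) \<le> (\<Sum>k\<in>{g..<n}. \<Sum>p\<in>P k. real (card (B p)))" by simp
  also have "\<dots> \<le> (\<Sum>k\<in>{g..<n}. \<Sum>p\<in>P k. w k)" using B(2) by (intro sum_mono) auto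
  also have "\<dots> = (\<Sum>k\<in>{g..<n}. real (card (P k)) * w k)" by simp
  also have "\<dots> \<le> (\<Sum>k\<in>{g..<n}. real (N k) * (5 * 2^k / 2^g) ^ ?d * w k)"
    using P(2) by (intro sum_mono mult_right_mono) (auto simp: w_def)
  \<comment> \<open>Here \<open>15 = 5 * 3\<close> and \<open>30 = 5 * 3 * 2\<close>: centres per
    level, cubes per ball, and the doubling from radius to diameter.\<close>
  also have "\<dots> = (\<Sum>k\<in>{g..<n}. 15^?d / 2^(?d * g) * (real (N k) * 2^(?d * k)) +
       30^?d * (2^j / 2^g)^?d * (real (N k) * \<rho>^k))"
  proof (rule sum.cong[OF refl])
    fix k
    have r: "(2^k)^?d * (((1/2)^k) powr a)^?d = \<rho>^k"
    proof -
      have "(2::real)^k * ((1/2)^k) powr a = (2 powr (1 - a))^k"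
        unfolding half_power_eq_powr
        by (simp add: powr_powr powr_power powr_realpow[symmetric] algebra_simps flip: powr_add)
      then have "(2^k)^?d * (((1/2)^k) powr a)^?d = ((2 powr (1 - a))^k)^?d"
        by (simp only: power_mult_distrib[symmetric])
      then show ?thesis unfolding \<rho>_def by (simp only: power_mult[symmetric] mult.commute)
    qed
    have "real (N k) * (5 * 2^k / 2^g) ^ ?d * w k =
      real (N k) * (5^?d * (2^k)^?d / (2^g)^?d) * (3^?d + 3^?d * ((2^j)^?d * (2^?d * (((1/2)^k) powr a)^?d)))"
      by (simp add: w_def power_mult_distrib power_divide algebra_simps)
    also have "\<dots> = 5^?d * 3^?d / (2^g)^?d * (real (N k) * (2^k)^?d) +
       (5^?d * 3^?d * 2^?d) * ((2^j)^?d / (2^g)^?d) * (real (N k) * ((2^k)^?d * (((1/2)^k) powr a)^?d))"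
      by (simp add: algebra_simps)
    also have "\<dots> = 15^?d / 2^(?d * g) * (real (N k) * 2^(?d * k)) + 30^?d * (2^j / 2^g)^?d * (real (N k) * \<rho>^k)"
    proof -
      have "5^?d * 3^?d = (15::real)^?d" "5^?d * 3^?d * 2^?d = (30::real)^?d"
        by (simp_all flip: power_mult_distrib)
      moreover have "((2::real)^m)^?d = 2^(?d * m)" for m by (simp only: power_mult[symmetric] mult.commute)
      ultimately show ?thesis unfolding r by (simp add: power_divide)
    qed
    finally show "real (N k) * (5 * 2^k / 2^g) ^ ?d * w k =
      15^?d / 2^(?d * g) * (real (N k) * 2^(?d * k)) + 30^?d * (2^j / 2^g)^?d * (real (N k) * \<rho>^k)" .
  qed
  also have "\<dots> = 15^?d / 2^(?d * g) * (\<Sum>k\<in>{g..<n}. real (N k) * 2^(?d * k)) +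
       30^?d * (2^j / 2^g)^?d * (\<Sum>k\<in>{g..<n}. real (N k) * \<rho>^k)"
    by (simp add: sum.distrib sum_distrib_left)
  also have "\<dots> \<le> 15^?d / 2^(?d * g) * (real (N n) * 2^(?d * n)) +
       30^?d * (2^j / 2^g)^?d * (\<Sum>k\<in>{g..<n}. real (N k) * \<rho>^k)"
  proof (intro add_right_mono mult_left_mono)
    have mono: "mono N" using C1 by (simp add: C1_with_def)
    have "(\<Sum>k\<in>{g..<n}. real (N k) * 2^(?d * k)) \<le> (\<Sum>k\<in>{g..<n}. real (N n) * 2^(?d * k))"
      using mono by (intro sum_mono mult_right_mono) (auto simp: mono_def)
    also have "\<dots> = real (N n) * (\<Sum>k\<in>{g..<n}. 2^(?d * k))" by (simp add: sum_distrib_left)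
    also have "\<dots> \<le> real (N n) * (\<Sum>k<n. 2^(?d * k))"
      by (intro mult_left_mono sum_mono2) auto
    also have "\<dots> \<le> real (N n) * 2^(?d * n)"
      by (intro mult_left_mono sum_powers_le_power) (auto simp: Suc_leI)
    finally show "(\<Sum>k\<in>{g..<n}. real (N k) * 2^(?d * k)) \<le> real (N n) * 2^(?d * n)" .
  qed auto
  finally show ?thesis by (simp add: \<rho>_def mult_ac)
qed

text \<open>Every coordinate of \<open>z\<close> is moved by \<open>R / 2\<close> away from the
  nearer face. A cube of side at most \<open>R / 8\<close> around the new point keeps its distances
  to \<open>z\<close> between \<open>3/8 * R\<close> and \<open>5/8 * R\<close>, and stays inside
  since \<open>R\<close> is at most half the side.\<close>

lemma dcube_at_distance:
  fixes z :: "real^'d"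
  assumes k: "valid_corner j k" and z: "z \<in> dcube j k" and R: "0 < R" "R \<le> (1/2)^(j+1)"
    and G: "(1/2)^G \<le> R / 8"
  obtains k' where "valid_corner G k'" "dcube G k' \<subseteq> dcube j k"
    "\<And>y. y \<in> dcube G k' \<Longrightarrow> linf_dist y z \<le> 5/8 * R"
    "\<And>y. y \<in> dcube G k' \<Longrightarrow> 3/8 * R \<le> linf_dist y z"
proof -
  define h where "h = (1/2::real)^j"
  have hp: "0 < h" by (simp add: h_def)
  have Rh: "R \<le> h / 2" using R(2) by (simp add: h_def)
  define l where "l i = real (k$i) / 2^j" for i
  have l0: "0 \<le> l i" for i by (simp add: l_def)
  have cube: "y \<in> dcube j k \<longleftrightarrow> (\<forall>i. l i \<le> y$i \<and> y$i \<le> l i + h)" for y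
    by (simp add: dcube_def l_def h_def add_divide_distrib power_one_over)
  have l1: "l i + h \<le> 1" for i
  proof -
    have "k$i + 1 \<le> 2^j" using k by (simp add: valid_corner_def Suc_leI)
    then have "real (k$i + 1) \<le> real (2^j)" by (simp only: of_nat_le_iff)
    then have "(real (k$i) + 1) / 2^j \<le> 1" by simp
    then show ?thesis by (simp add: l_def h_def add_divide_distrib power_one_over)
  qed
  define c :: "real^'d" where "c = (\<chi> i. if z$i \<le> l i + h / 2 then z$i + R / 2 else z$i - R / 2)"
  have zi: "l i \<le> z$i" "z$i \<le> l i + h" for i using z cube by blast+
  have c1: "0 \<le> c$i" "c$i < 1" for i
    using zi[of i] l0[of i] l1[of i] R(1) Rh hp by (auto simp: c_def)
  obtain k' where k': "valid_corner G k'" "c \<in> dcube G k'" using dcube_containing[of c, OF c1] .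
  have yc: "\<bar>y$i - c$i\<bar> \<le> R / 8" if "y \<in> dcube G k'" for y i
    using dist_in_dcube[OF that k'(2)] component_le_linf_dist[of y i c] G by linarith
  show ?thesis
  proof
    show "valid_corner G k'" by fact
    show "dcube G k' \<subseteq> dcube j k"
    proof
      fix y assume y: "y \<in> dcube G k'"
      have "l i \<le> y$i \<and> y$i \<le> l i + h" for i
        using yc[OF y, of i] zi[of i] R(1) Rh hp unfolding c_def vec_lambda_beta
        by (cases "z$i \<le> l i + h / 2") (simp_all only: if_True if_False, linarith+)
      then show "y \<in> dcube j k" by (simp add: cube)
    qed
    fix y assume y: "y \<in> dcube G k'"
    have cz: "\<bar>c$i - z$i\<bar> = R / 2" for i using R(1) by (simp add: c_def)
    have "\<bar>y$i - z$i\<bar> \<le> 5/8 * R" for i using yc[OF y, of i] cz[of i] by linarith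
    then show "linf_dist y z \<le> 5/8 * R" unfolding linf_dist_le_iff ..
    obtain i :: 'd where True by blast
    have "3/8 * R \<le> \<bar>y$i - z$i\<bar>" using yc[OF y, of i] cz[of i] by linarith
    then show "3/8 * R \<le> linf_dist y z" using component_le_linf_dist[of y i z] by linarith
  qed
qed

section \<open>The nested construction\<close>

text \<open>\<open>a\<close> and \<open>M\<close> are to bracket the values of \<open>f\<close> on
  the starting cube, \<open>\<kappa>0\<close> bounds \<kappa> from below on that range, and
  \<open>A\<close>, \<open>t\<close> are the cover to be avoided. By \<open>tail\<close>, the volume
  part of \<open>card_dcubes_near_system\<close> costs at most a quarter of the share
  \<open>\<kappa>0\<close> from generation \<open>g0\<close> on.\<close>

locale ubiquity =
  fixes x :: "nat \<Rightarrow> real^'d" and r :: "nat \<Rightarrow> real" and N :: "nat \<Rightarrow> nat" and \<phi> :: "real \<Rightarrow> real"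
    and a M s \<kappa>0 :: real and A :: "nat \<Rightarrow> (real^'d) set" and t :: "nat \<Rightarrow> real" and g0 :: nat
  assumes sys: "is_system x r" and C1N: "C1_with x r N" and phi: "\<phi> \<in> Phi_class"
    and a: "1 < a" and s: "0 < s" and Ms: "M * s < real CARD('d)"
    and \<kappa>0: "0 < \<kappa>0" "\<kappa>0 \<le> 1"
    and tpos: "\<And>i. 0 < t i"
    and diam: "\<And>i p q. p \<in> A i \<Longrightarrow> q \<in> A i \<Longrightarrow> linf_dist p q \<le> t i"
    and sm: "summable (\<lambda>i. t i powr s)"
    and g0: "1 \<le> g0"
    and tail: "\<And>n. 30^CARD('d) * (\<Sum>k\<in>{g0..<n}. real (N k) * ((2 powr (1 - a))^CARD('d))^k) \<le> \<kappa>0 / 4"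
begin

text \<open>Makes \<open>3^d * c\<close> equal to \<open>\<kappa>0 / 4\<close>, so that the volume
  part of \<open>card_heavy_dcubes\<close> costs a quarter of the share
  \<open>\<kappa>0\<close>.\<close>

definition c :: real where "c = \<kappa>0 / (4 * 3^CARD('d))"

lemma c: "0 < c" "c < 1"
proof -
  show "0 < c" using \<kappa>0 by (simp add: c_def)
  have "(1::real) \<le> 3^CARD('d)" by simp
  then have "\<kappa>0 < 4 * 3^CARD('d)" using \<kappa>0 by linarith
  then show "c < 1" by (simp add: c_def)
qed

lemma rpos: "0 < r p"
  using sys by (simp add: is_system_def)

definition light :: "nat \<Rightarrow> nat^'d \<Rightarrow> bool" where
  "light g k \<longleftrightarrow> cover_mass A t s (dcube g k) \<le> c * 2 powr (- real g * s)"

text \<open>A single set that meets the cube already weighs \<open>t i powr s\<close>, and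
  \<open>c < 1\<close>. A point lying in light cubes of arbitrarily small side is therefore in no
  \<open>A i\<close>.\<close>

lemma light_imp_small:
  assumes "light g k" "A i \<inter> dcube g k \<noteq> {}"
  shows "t i < (1/2)^g"
proof -
  have "t i powr s \<le> c * 2 powr (- real g * s)"
    using cover_mass_term[where t=t and s=s and A=A and i=i, OF sm assms(2)] assms(1) by (simp add: light_def)
  also have "\<dots> < 1 * 2 powr (- real g * s)" using c by (intro mult_strict_right_mono) auto
  also have "\<dots> = ((1/2)^g) powr s" unfolding half_power_eq_powr by (simp add: powr_powr)
  finally show ?thesis
    using powr_mono2[of s "(1/2)^g" "t i"] s by (meson not_le zero_le_power zero_le_divide_1_iff zero_le_numeral less_imp_le)
qed

text \<open>Of the share \<open>\<kappa>0\<close>, heavy cubes take at most \<open>1/8 + 1/4\<close>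
  and cubes near the system another \<open>1/8 + 1/4\<close>, so some cube remains. Its mass is
  measured against \<open>G\<close>, the generation of the smaller cube to be placed inside
  it.\<close>

lemma select_cube:
  assumes g: "g0 \<le> g" and light: "light g kU"
    and Q: "\<kappa>0 * (2^j / 2^g)^CARD('d) \<le> real (card Q)"
    and sub: "\<And>l. l \<in> Q \<Longrightarrow> dcube j l \<subseteq> dcube g kU"
    and m: "real (N m) * 2 ^ (CARD('d) * m) \<le> \<kappa>0 / (8 * 15^CARD('d)) * 2 ^ (CARD('d) * j)"
    and G: "3^CARD('d) * 2 powr ((G - real g) * s) \<le> \<kappa>0 / 8 * (2^j / 2^g)^CARD('d)"
    and sd: "s \<le> real CARD('d)"
  obtains l where "l \<in> Q" "cover_mass A t s (dcube j l) \<le> c * 2 powr (- G * s)"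
    "\<And>k p y. g \<le> k \<Longrightarrow> k < m \<Longrightarrow> p \<in> T_idx x r k \<Longrightarrow> y \<in> dcube j l \<Longrightarrow> r p powr a < linf_dist y (x p)"
proof -
  let ?d = "CARD('d)" and ?X = "(2^j / 2^g)^CARD('d) :: real"
  have X: "0 < ?X" by simp
  have "0 < real (card Q)" using Q X \<kappa>0 by (meson less_le_trans mult_pos_pos)
  then have finQ: "finite Q" using card_ge_0_finite by auto
  define F1 where "F1 = {l\<in>Q. c * 2 powr (- G * s) < cover_mass A t s (dcube j l)}"
  define F2 where "F2 = {l\<in>Q. \<exists>k p y. g \<le> k \<and> k < m \<and> p \<in> T_idx x r k \<and> y \<in> dcube j l \<and>
                linf_dist y (x p) \<le> r p powr a}"
  have "real (card F1) \<le> 3^?d * (2 powr ((G - real g) * s) + c * ?X)"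
  proof (rule card_heavy_dcubes[OF tpos diam sm s sd c(1) less_imp_le[OF c(2)]])
    show "cover_mass A t s (dcube g kU) \<le> c * 2 powr (- real g * s)" using light by (simp add: light_def)
  qed (use finQ sub in \<open>auto simp: F1_def\<close>)
  also have "\<dots> \<le> \<kappa>0 / 8 * ?X + \<kappa>0 / 4 * ?X"
    using G by (simp add: distrib_left c_def)
  finally have c1: "real (card F1) \<le> \<kappa>0 / 8 * ?X + \<kappa>0 / 4 * ?X" .
  have "real (card F2) \<le> 15^?d * (real (N m) * 2^(?d * m) / 2^(?d * g))
    + 30^?d * ?X * (\<Sum>k\<in>{g..<m}. real (N k) * ((2 powr (1 - a))^?d)^k)"
    using g g0 by (intro card_dcubes_near_system[OF sys C1N _ a]) (auto simp: F2_def dest: sub)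
  also have "\<dots> \<le> \<kappa>0 / 8 * ?X + \<kappa>0 / 4 * ?X"
  proof (rule add_mono)
    have "15^?d * (real (N m) * 2^(?d * m) / 2^(?d * g)) \<le>
        15^?d * (\<kappa>0 / (8 * 15^?d) * 2^(?d * j) / 2^(?d * g))"
      using m by (intro mult_left_mono divide_right_mono) auto
    also have "\<dots> = \<kappa>0 / 8 * ?X"
      by (simp add: power_divide power_mult[symmetric] mult.commute)
    finally show "15^?d * (real (N m) * 2^(?d * m) / 2^(?d * g)) \<le> \<kappa>0 / 8 * ?X" .
    have "(\<Sum>k\<in>{g..<m}. real (N k) * ((2 powr (1 - a))^?d)^k) \<le>
        (\<Sum>k\<in>{g0..<m}. real (N k) * ((2 powr (1 - a))^?d)^k)"
      using g by (intro sum_mono2) auto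
    then have "30^?d * (\<Sum>k\<in>{g..<m}. real (N k) * ((2 powr (1 - a))^?d)^k) \<le> \<kappa>0 / 4"
      using tail[of m] by (meson mult_left_mono order_trans zero_le_numeral zero_le_power)
    then have "30^?d * (\<Sum>k\<in>{g..<m}. real (N k) * ((2 powr (1 - a))^?d)^k) * ?X \<le> \<kappa>0 / 4 * ?X"
      by (rule mult_right_mono) simp
    then show "30^?d * ?X * (\<Sum>k\<in>{g..<m}. real (N k) * ((2 powr (1 - a))^?d)^k) \<le> \<kappa>0 / 4 * ?X"
      by (simp only: mult_ac)
  qed
  finally have c2: "real (card F2) \<le> \<kappa>0 / 8 * ?X + \<kappa>0 / 4 * ?X" .
  have "0 < \<kappa>0 * ?X" using \<kappa>0 X by simp
  then have "real (card F1) + real (card F2) < real (card Q)" using c1 c2 Q by linarith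
  then have "card (F1 \<union> F2) < card Q" using card_Un_le[of F1 F2] by linarith
  moreover have "F1 \<union> F2 \<subseteq> Q" by (auto simp: F1_def F2_def)
  ultimately have "\<exists>l\<in>Q. l \<notin> F1 \<union> F2" by (metis order_less_irrefl subsetI subset_antisym)
  then obtain l where l: "l \<in> Q" "l \<notin> F1" "l \<notin> F2" by blast
  show ?thesis
  proof (rule that[OF l(1)])
    show "cover_mass A t s (dcube j l) \<le> c * 2 powr (- G * s)" using l by (simp add: F1_def)
    show "r p powr a < linf_dist y (x p)"
      if "g \<le> k" "k < m" "p \<in> T_idx x r k" "y \<in> dcube j l" for k p y
    proof (rule ccontr)
      assume "\<not> r p powr a < linf_dist y (x p)"
      then have "linf_dist y (x p) \<le> r p powr a" by simp
      then have "l \<in> F2" unfolding F2_def using l(1) that by blast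
      then show False using l by blast
    qed
  qed
qed

text \<open>In \<open>j\<close> the left side grows with exponent \<open>M * s\<close>, the right
  side with the larger exponent \<open>CARD('d)\<close>.\<close>

lemma eventually_generation_fits:
  "\<forall>\<^sub>F j::nat in sequentially. 3^CARD('d) * 2 powr ((M * (real j + 1) + 4 - real g) * s)
      \<le> \<kappa>0 / 8 * (2^j / 2^g)^CARD('d)"
proof -
  let ?d = "CARD('d)"
  define C where "C = 3^?d * 2 powr ((M + 4 - real g) * s) * 2 powr (real ?d * real g) * 8 / \<kappa>0"
  have C: "0 < C" using \<kappa>0 by (simp add: C_def)
  define e where "e = real ?d - M * s"
  have e: "0 < e" using Ms by (simp add: e_def)
  have "\<forall>\<^sub>F j::nat in sequentially. log 2 C / e \<le> real j"
    by (rule eventually_sequentiallyI[of "nat \<lceil>log 2 C / e\<rceil>"]) linarith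
  then show ?thesis
  proof eventually_elim
    case (elim j)
    then have "log 2 C \<le> e * real j" using e by (simp add: field_simps)
    then have Cj: "C \<le> 2 powr (e * real j)" using C by (simp add: log_le_iff)
    have p: "(2::real)^i = 2 powr real i" for i by (simp add: powr_realpow)
    have "3^?d * 2 powr ((M * (real j + 1) + 4 - real g) * s)
        = \<kappa>0 / 8 * (C * 2 powr (M * s * real j - real ?d * real g))"
      unfolding C_def using \<kappa>0 by (simp add: algebra_simps flip: powr_add)
    also have "\<dots> \<le> \<kappa>0 / 8 * (2 powr (e * real j) * 2 powr (M * s * real j - real ?d * real g))"
      using Cj \<kappa>0 by (intro mult_left_mono mult_right_mono) auto
    also have "2 powr (e * real j) * 2 powr (M * s * real j - real ?d * real g)
        = 2 powr (real ?d * (real j - real g))"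
      unfolding e_def by (simp add: algebra_simps flip: powr_add)
    also have "\<dots> = (2^j / 2^g)^?d"
      unfolding p powr_diff[symmetric] by (simp add: powr_power mult.commute)
    finally show ?case .
  qed
qed

text \<open>
  The factor \<open>1 + \<epsilon>\<close> absorbs the gap between \<open>\<gamma>(j)\<close> and \<open>j\<close>. It also makes the exponent exceed
  \<open>a\<close>, so that the same bound covers the scales below \<open>\<gamma>(j)\<close>.
\<close>

lemma light_child:
  assumes g: "g0 \<le> g" and kU: "valid_corner g kU" and light: "light g kU"
    and \<delta>: "a < \<delta>" "\<delta> < M" and \<epsilon>: "0 < \<epsilon>"
    and inf: "infinite {j. g \<le> j \<and>
       \<kappa>0 * 2 powr (real CARD('d) * (real j - real g)) \<le> real (card (Q_set x r \<phi> N g kU j \<delta>))}"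
  obtains G k' n where "g < G" "valid_corner G k'" "dcube G k' \<subseteq> dcube g kU" "light G k'"
    "r n < (1/2)^g"
    "\<And>y. y \<in> dcube G k' \<Longrightarrow> linf_dist y (x n) \<le> r n powr \<delta>"
    "\<And>y p. y \<in> dcube G k' \<Longrightarrow> p \<in> irred_idx x \<Longrightarrow> (1/2)^G < r p \<Longrightarrow> r p \<le> (1/2)^g \<Longrightarrow>
        r p powr ((1 + \<epsilon>) * \<delta>) < linf_dist y (x p)"
proof -
  let ?d = "CARD('d)"
  \<comment> \<open>Small enough both for comparing scales with \<open>\<epsilon>\<close> and for
    the count demanded by \<open>select_cube\<close>.\<close>
  define \<epsilon>' where "\<epsilon>' = min \<epsilon> (\<kappa>0 / (8 * 15^?d))"
  have \<epsilon>': "0 < \<epsilon>'" using \<epsilon> \<kappa>0 by (simp add: \<epsilon>'_def)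
  \<comment> \<open>Makes \<open>\<delta> * j \<ge> j + 1\<close>, so that the ball around the
    chosen centre has radius at most half the side of its cube.\<close>
  have "\<forall>\<^sub>F j::nat in sequentially. 1 / (a - 1) \<le> real j"
    by (rule eventually_sequentiallyI[of "nat \<lceil>1 / (a - 1)\<rceil>"]) linarith
  moreover have "\<forall>\<^sub>F j::nat in sequentially. g < j" by (rule eventually_gt_at_top)
  moreover have "1 \<le> ?d" by (simp add: Suc_leI)
  note gamma_fun_eventually[OF phi C1N \<epsilon>' this]
  moreover note eventually_generation_fits[of g]
  ultimately have "\<forall>\<^sub>F j in sequentially. 1 / (a - 1) \<le> real j \<and> g < j \<and>
     (real j + 3 \<le> (1 + \<epsilon>') * real (gamma_fun ?d \<phi> N j) \<and>
      real (N (gamma_fun ?d \<phi> N j)) * 2 ^ (?d * gamma_fun ?d \<phi> N j) \<le> \<epsilon>' * 2 ^ (?d * j)) \<and>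
     3^CARD('d) * 2 powr ((M * (real j + 1) + 4 - real g) * s) \<le> \<kappa>0 / 8 * (2^j / 2^g)^CARD('d)"
    by eventually_elim blast
  then obtain J where J: "\<And>j. j \<ge> J \<Longrightarrow> 1 / (a - 1) \<le> real j \<and> g < j \<and>
     (real j + 3 \<le> (1 + \<epsilon>') * real (gamma_fun ?d \<phi> N j) \<and>
      real (N (gamma_fun ?d \<phi> N j)) * 2 ^ (?d * gamma_fun ?d \<phi> N j) \<le> \<epsilon>' * 2 ^ (?d * j)) \<and>
     3^CARD('d) * 2 powr ((M * (real j + 1) + 4 - real g) * s) \<le> \<kappa>0 / 8 * (2^j / 2^g)^CARD('d)"
    unfolding eventually_sequentially by blast
  obtain j where j: "J < j" "g \<le> j"
    "\<kappa>0 * 2 powr (real ?d * (real j - real g)) \<le> real (card (Q_set x r \<phi> N g kU j \<delta>))"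
    using inf unfolding infinite_nat_iff_unbounded by blast
  define m where "m = gamma_fun ?d \<phi> N j"
  have ja: "1 / (a - 1) \<le> real j" and gj: "g < j" and jm: "real j + 3 \<le> (1 + \<epsilon>') * real m"
    and Nm: "real (N m) * 2 ^ (?d * m) \<le> \<epsilon>' * 2 ^ (?d * j)"
    and fits: "3^?d * 2 powr ((M * (real j + 1) + 4 - real g) * s) \<le> \<kappa>0 / 8 * (2^j / 2^g)^?d"
    using J[OF less_imp_le[OF j(1)]] unfolding m_def by blast+
  have \<delta>1: "1 < \<delta>" using \<delta> a by linarith
  define F where "F = \<lfloor>\<delta> * (real j + 1)\<rfloor>"
  have F0: "0 \<le> F" using \<delta>1 by (simp add: F_def)
  \<comment> \<open>The upper end of the scale window in \<open>prop_P\<close>, so that the window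
    reaches exactly to the new cube. The summand 4 also yields
    \<open>2^-G \<le> R / 8\<close>.\<close>
  define G where "G = nat F + 4"
  have GF: "real G = real_of_int F + 4" using F0 by (simp add: G_def)
  have G1: "\<delta> * (real j + 1) + 3 < real G" unfolding GF F_def by linarith
  have G2: "real G \<le> \<delta> * (real j + 1) + 4" unfolding GF F_def by linarith
  have "1 * (real j + 1) \<le> \<delta> * (real j + 1)" using \<delta>1 by (intro mult_right_mono) auto
  then have "real j < \<delta> * (real j + 1) + 3" unfolding mult_1_left by (rule less_le_trans[rotated, OF add_right_mono]) simp
  also note G1
  finally have "real j < real G" .
  then have jG: "j < G" by simp
  have sd: "s \<le> real ?d"
  proof -
    have "1 * s \<le> M * s" using \<delta> \<delta>1 s by (intro mult_right_mono) auto
    then show ?thesis using Ms by simp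
  qed
  have p: "(2::real)^i = 2 powr real i" for i by (simp add: powr_realpow)
  have X: "2 powr (real ?d * (real j - real g)) = (2^j / 2^g)^?d"
    unfolding p powr_diff[symmetric] by (simp add: powr_power mult.commute)
  have Gfit: "3^?d * 2 powr ((real G - real g) * s) \<le> \<kappa>0 / 8 * (2^j / 2^g)^?d"
  proof -
    have "\<delta> * (real j + 1) \<le> M * (real j + 1)" using \<delta> by (intro mult_right_mono) auto
    then have "\<delta> * (real j + 1) + 4 \<le> M * (real j + 1) + 4" by (rule add_right_mono)
    from order_trans[OF G2 this] have "(real G - real g) * s \<le> (M * (real j + 1) + 4 - real g) * s"
      using s by (intro mult_right_mono diff_right_mono) auto
    then have "3^?d * 2 powr ((real G - real g) * s) \<le> 3^?d * 2 powr ((M * (real j + 1) + 4 - real g) * s)"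
      by (intro mult_left_mono powr_mono) auto
    then show ?thesis using fits by linarith
  qed
  have "\<epsilon>' * 2 ^ (?d * j) \<le> \<kappa>0 / (8 * 15^?d) * 2 ^ (?d * j)"
    by (intro mult_right_mono) (auto simp: \<epsilon>'_def)
  then have Nm': "real (N m) * 2 ^ (?d * m) \<le> \<kappa>0 / (8 * 15^?d) * 2 ^ (?d * j)" using Nm by linarith
  obtain l where l: "l \<in> Q_set x r \<phi> N g kU j \<delta>" "cover_mass A t s (dcube j l) \<le> c * 2 powr (- real G * s)"
    and far: "\<And>k p y. g \<le> k \<Longrightarrow> k < m \<Longrightarrow> p \<in> T_idx x r k \<Longrightarrow> y \<in> dcube j l \<Longrightarrow> r p powr a < linf_dist y (x p)"
  proof (rule select_cube[OF g light _ _ Nm' Gfit sd, of "Q_set x r \<phi> N g kU j \<delta>"])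
    show "\<kappa>0 * (2^j / 2^g)^?d \<le> real (card (Q_set x r \<phi> N g kU j \<delta>))" using j(3) by (simp only: X)
  qed (auto simp: Q_set_def)
  have lv: "valid_corner j l" and lsub: "dcube j l \<subseteq> dcube g kU" and lP: "prop_P x r \<phi> N j l \<delta>"
    using l(1) by (auto simp: Q_set_def)
  obtain n where n: "x n \<in> dcube j l" "(1/2)^(j+1) \<le> r n" "r n < (1/2)^j"
    "cball_inf (x n) (r n powr \<delta>) \<inter> {x p | p. real m \<le> - log 2 (r p) \<and>
                    - log 2 (r p) < real_of_int F + 4} = {x n}"
    using lP unfolding prop_P_def m_def F_def by blast
  define R where "R = r n powr \<delta>"
  have R0: "0 < R" using rpos[of n] by (simp add: R_def)
  have Rlow: "2 powr (- ((real j + 1) * \<delta>)) \<le> R"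
  proof -
    have "2 powr (- ((real j + 1) * \<delta>)) = ((1/2)^(j+1)) powr \<delta>"
      unfolding half_power_eq_powr by (simp add: powr_powr algebra_simps)
    also have "\<dots> \<le> R" unfolding R_def using n(2) \<delta>1 by (intro powr_mono2) auto
    finally show ?thesis .
  qed
  have Rup: "R \<le> (1/2)^(j+1)"
  proof -
    have "R \<le> ((1/2)^j) powr \<delta>" unfolding R_def using n(3) rpos[of n] \<delta>1 by (intro powr_mono2) auto
    also have "\<dots> = 2 powr (- (real j * \<delta>))" unfolding half_power_eq_powr by (simp add: powr_powr)
    also have "\<dots> \<le> 2 powr (- real (j + 1))"
    proof (rule powr_mono)
      have "1 \<le> (a - 1) * real j" using ja a by (simp add: field_simps)
      also have "\<dots> \<le> (\<delta> - 1) * real j" using \<delta> by (intro mult_right_mono) auto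
      finally show "- (real j * \<delta>) \<le> - real (j + 1)" by (simp add: algebra_simps)
    qed simp
    finally show ?thesis by (simp only: half_power_eq_powr)
  qed
  have GR: "(1/2)^G \<le> R / 8"
  proof -
    have "(1/2)^G \<le> 2 powr (- ((real j + 1) * \<delta>) - 3)"
      unfolding half_power_eq_powr using G1 by (intro powr_mono) (auto simp: mult.commute)
    also have "\<dots> = 2 powr (- ((real j + 1) * \<delta>)) / 8" by (simp add: powr_diff)
    also have "\<dots> \<le> R / 8" using Rlow by simp
    finally show ?thesis .
  qed
  obtain k' where k': "valid_corner G k'" "dcube G k' \<subseteq> dcube j l"
    and up: "\<And>y. y \<in> dcube G k' \<Longrightarrow> linf_dist y (x n) \<le> 5/8 * R"
    and low: "\<And>y. y \<in> dcube G k' \<Longrightarrow> 3/8 * R \<le> linf_dist y (x n)"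
    using dcube_at_distance[OF lv n(1) R0 Rup GR] by metis
  show ?thesis
  proof
    show "g < G" using gj jG by simp
    show "valid_corner G k'" by fact
    show "dcube G k' \<subseteq> dcube g kU" using k'(2) lsub by blast
    show "light G k'"
      unfolding light_def using cover_mass_mono[where t=t and s=s and A=A, OF sm k'(2)] l(2) by linarith
    have "(1/2::real)^j \<le> (1/2)^g" using gj by (intro power_decreasing) auto
    then show "r n < (1/2)^g" using n(3) by linarith
    show "linf_dist y (x n) \<le> r n powr \<delta>" if "y \<in> dcube G k'" for y
      using up[OF that] R0 unfolding R_def[symmetric] by linarith
    fix y p assume y: "y \<in> dcube G k'" and p: "p \<in> irred_idx x" "(1/2)^G < r p" "r p \<le> (1/2)^g"
    \<comment> \<open>Scales from \<open>m\<close> on are governed by \<open>prop_P\<close>, coarser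
      ones by the choice made in \<open>select_cube\<close>.\<close>
    show "r p powr ((1 + \<epsilon>) * \<delta>) < linf_dist y (x p)"
    proof (cases "real m \<le> - log 2 (r p)")
      case True
      have "log 2 ((1/2)^G) < log 2 (r p)" using p(2) rpos[of p] by (subst log_less_cancel_iff) auto
      moreover have "log 2 ((1/2)^G) = - real G" unfolding half_power_eq_powr by simp
      ultimately have lG: "- log 2 (r p) < real_of_int F + 4" using GF by simp
      \<comment> \<open>The centre \<open>x n\<close> is kept away by the lower distance bound of
        the new cube. Any other centre in the window lies outside the ball of radius
        \<open>R\<close>, while \<open>y\<close> is within \<open>5/8 * R\<close> of
        \<open>x n\<close>.\<close>
      have "3/8 * R \<le> linf_dist y (x p)"
      proof (cases "x p = x n")
        case True
        then show ?thesis using low[OF y] by simp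
      next
        case False
        then have "x p \<notin> cball_inf (x n) R" using n(4) True lG unfolding R_def by blast
        then have "R < linf_dist (x n) (x p)" by (simp add: cball_inf_def)
        also have "\<dots> \<le> linf_dist y (x n) + linf_dist y (x p)"
          using linf_dist_triangle[of "x n" "x p" y] by (simp add: linf_dist_commute)
        finally show ?thesis using up[OF y] by linarith
      qed
      \<comment> \<open>From \<open>(1 + \<epsilon>) * m \<ge> j + 3\<close> and
        \<open>\<delta> > 1\<close> the exponent gains 2 over \<open>(j + 1) * \<delta>\<close>, so
        the power is at most \<open>R / 4\<close>.\<close>
      moreover have "r p powr ((1 + \<epsilon>) * \<delta>) < 3/8 * R"
      proof -
        have "log 2 (r p) \<le> - real m" using True by simp
        then have "r p \<le> 2 powr (- real m)" using rpos[of p] by (simp add: log_le_iff)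
        then have "r p powr ((1 + \<epsilon>) * \<delta>) \<le> (2 powr (- real m)) powr ((1 + \<epsilon>) * \<delta>)"
          using rpos[of p] \<epsilon> \<delta>1 by (intro powr_mono2) auto
        also have "\<dots> = 2 powr (- ((1 + \<epsilon>) * real m * \<delta>))" by (simp add: powr_powr mult_ac)
        also have "\<dots> \<le> 2 powr (- ((real j + 1) * \<delta>) - 2)"
        proof (rule powr_mono)
          have "(1 + \<epsilon>') * real m \<le> (1 + \<epsilon>) * real m" by (intro mult_right_mono) (auto simp: \<epsilon>'_def)
          then have "(real j + 3) * \<delta> \<le> (1 + \<epsilon>) * real m * \<delta>"
            using jm \<delta>1 by (intro mult_right_mono) auto
          then show "- ((1 + \<epsilon>) * real m * \<delta>) \<le> - ((real j + 1) * \<delta>) - 2"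
            using \<delta>1 by (simp add: algebra_simps)
        qed simp
        also have "\<dots> = 2 powr (- ((real j + 1) * \<delta>)) / 4" by (simp add: powr_diff)
        also have "\<dots> < 3/8 * R" using Rlow R0 by simp
        finally show ?thesis .
      qed
      ultimately show ?thesis by linarith
    next
      case False
      obtain k where k: "g \<le> k" "(1/2)^(k+1) < r p" "r p \<le> (1/2)^k"
        using dyadic_level[OF rpos p(3)] .
      have "log 2 (r p) \<le> log 2 ((1/2)^k)" using k(3) rpos[of p] by (subst log_le_cancel_iff) auto
      moreover have "log 2 ((1/2)^k) = - real k" unfolding half_power_eq_powr by simp
      ultimately have "k < m" using False by simp
      moreover have "p \<in> T_idx x r k" using p(1) k by (simp add: T_idx_def)
      ultimately have "r p powr a < linf_dist y (x p)" using far[OF k(1)] y k'(2) by blast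
      moreover have "r p powr ((1 + \<epsilon>) * \<delta>) \<le> r p powr a"
      proof (rule powr_mono')
        have "1 * \<delta> \<le> (1 + \<epsilon>) * \<delta>" using \<epsilon> \<delta>1 by (intro mult_right_mono) auto
        then show "a \<le> (1 + \<epsilon>) * \<delta>" using \<delta> by linarith
        have "(1/2::real)^g \<le> 1" by (simp add: power_le_one)
        then show "r p \<le> 1" using p(3) by linarith
      qed (use rpos[of p] in simp)
      ultimately show ?thesis by linarith
    qed
  qed
qed

end

section \<open>The limit point and its approximation rate\<close>

context ubiquity
begin

text \<open>
  Putting the points \<open>x n\<close> into the \<open>A i\<close> rules out that \<open>y\<close> is one of them; otherwise a point repeated
  infinitely often in the system would give it an infinite rate.
\<close>

lemma exists_point:
  assumes \<Delta>: "{1<..} \<subseteq> closure \<Delta>"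
    and Q: "\<And>\<delta> g kU. \<delta> \<in> \<Delta> \<Longrightarrow> a < \<delta> \<Longrightarrow> \<delta> < M \<Longrightarrow> valid_corner g kU \<Longrightarrow> infinite {j. g \<le> j \<and>
       \<kappa>0 * 2 powr (real CARD('d) * (real j - real g)) \<le> real (card (Q_set x r \<phi> N g kU j \<delta>))}"
    and k0: "valid_corner g0 k0" "light g0 k0" "dcube g0 k0 \<subseteq> open_unit_cube"
    and f: "continuous_on open_unit_cube f" "\<And>y. y \<in> dcube g0 k0 \<Longrightarrow> a < f y \<and> f y < M"
    and xA: "range x \<subseteq> \<Union>(range A)"
  obtains y where "y \<in> dcube g0 k0" "y \<notin> \<Union>(range A)" "approx_rate x r y = ereal (f y)"
proof -
  \<comment> \<open>The corner of a cube is the sample point at which \<open>f\<close> is evaluated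
    to choose the next exponent.\<close>
  define pt :: "nat \<times> (nat^'d) \<Rightarrow> real^'d" where "pt \<sigma> = (\<chi> i. real (snd \<sigma> $ i) / 2 ^ fst \<sigma>)" for \<sigma>
  define D where "D \<sigma> = dcube (fst \<sigma>) (snd \<sigma>)" for \<sigma> :: "nat \<times> (nat^'d)"
  have ptD: "pt \<sigma> \<in> D \<sigma>" for \<sigma> unfolding pt_def D_def by (rule corner_in_dcube)
  define P where "P \<sigma> \<longleftrightarrow> g0 \<le> fst \<sigma> \<and> valid_corner (fst \<sigma>) (snd \<sigma>) \<and> light (fst \<sigma>) (snd \<sigma>) \<and>
      D \<sigma> \<subseteq> dcube g0 k0" for \<sigma>
  define S where "S n \<sigma> \<tau> \<delta> m \<longleftrightarrow> fst \<sigma> < fst \<tau> \<and> D \<tau> \<subseteq> D \<sigma> \<and> \<bar>\<delta> - f (pt \<sigma>)\<bar> < 1 / (real n + 1) \<and>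
      a < \<delta> \<and> r m < (1/2)^fst \<sigma> \<and> (\<forall>y\<in>D \<tau>. linf_dist y (x m) \<le> r m powr \<delta>) \<and>
      (\<forall>y\<in>D \<tau>. \<forall>p\<in>irred_idx x. (1/2)^fst \<tau> < r p \<and> r p \<le> (1/2)^fst \<sigma> \<longrightarrow>
        r p powr ((1 + 1 / (real n + 1)) * \<delta>) < linf_dist y (x p))" for n \<sigma> \<tau> \<delta> m
  have "\<exists>\<sigma>. \<forall>n. P (\<sigma> n) \<and> (\<exists>\<delta> m. S n (\<sigma> n) (\<sigma> (Suc n)) \<delta> m)"
  proof (rule dependent_nat_choice)
    show "\<exists>\<sigma>. P \<sigma>" using k0 by (intro exI[of _ "(g0, k0)"]) (simp add: P_def D_def)
    fix \<sigma> n assume \<sigma>: "P \<sigma>"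
    then have fp: "a < f (pt \<sigma>)" "f (pt \<sigma>) < M" using f(2) ptD unfolding P_def by blast+
    \<comment> \<open>Accuracy \<open>1 / (n + 1)\<close>, together with the margins that keep the
      exponent between \<open>a\<close> and \<open>M\<close>.\<close>
    define e where "e = min (1 / (real n + 1)) (min (f (pt \<sigma>) - a) (M - f (pt \<sigma>)))"
    have "0 < e" using fp by (simp add: e_def)
    moreover have "f (pt \<sigma>) \<in> closure \<Delta>" using fp a \<Delta> by auto
    ultimately obtain \<delta> where \<delta>: "\<delta> \<in> \<Delta>" "dist \<delta> (f (pt \<sigma>)) < e" unfolding closure_approachable by blast
    then have \<delta>': "\<bar>\<delta> - f (pt \<sigma>)\<bar> < 1 / (real n + 1)" "a < \<delta>" "\<delta> < M" by (auto simp: e_def dist_real_def)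
    have n1: "0 < 1 / (real n + 1)" by simp
    have \<sigma>': "g0 \<le> fst \<sigma>" "valid_corner (fst \<sigma>) (snd \<sigma>)" "light (fst \<sigma>) (snd \<sigma>)" "D \<sigma> \<subseteq> dcube g0 k0"
      using \<sigma> by (auto simp: P_def)
    obtain G k' m where "fst \<sigma> < G" "valid_corner G k'" "dcube G k' \<subseteq> dcube (fst \<sigma>) (snd \<sigma>)" "light G k'"
      "r m < (1/2)^fst \<sigma>"
      "\<And>y. y \<in> dcube G k' \<Longrightarrow> linf_dist y (x m) \<le> r m powr \<delta>"
      "\<And>y p. y \<in> dcube G k' \<Longrightarrow> p \<in> irred_idx x \<Longrightarrow> (1/2)^G < r p \<Longrightarrow> r p \<le> (1/2)^fst \<sigma> \<Longrightarrow>
        r p powr ((1 + 1 / (real n + 1)) * \<delta>) < linf_dist y (x p)"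
      using light_child[OF \<sigma>'(1-3) \<delta>'(2,3) n1 Q[OF \<delta>(1) \<delta>'(2,3) \<sigma>'(2)]] by metis
    then have "P (G, k') \<and> S n \<sigma> (G, k') \<delta> m" using \<sigma>' \<delta>' by (auto simp: P_def S_def D_def)
    then show "\<exists>\<tau>. P \<tau> \<and> (\<exists>\<delta> m. S n \<sigma> \<tau> \<delta> m)" by blast
  qed
  then obtain \<sigma> where \<sigma>: "\<And>n. P (\<sigma> n)" and ex: "\<forall>n. \<exists>\<delta> m. S n (\<sigma> n) (\<sigma> (Suc n)) \<delta> m" by blast
  from ex obtain \<delta> m where S: "\<And>n. S n (\<sigma> n) (\<sigma> (Suc n)) (\<delta> n) (m n)" by metis
  define g where "g n = fst (\<sigma> n)" for n
  have "g n < g (Suc n)" for n using S[of n] by (simp add: S_def g_def)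
  then have gmono: "strict_mono g" by (simp add: strict_mono_Suc_iff)
  have gn: "n \<le> g n" for n by (rule strict_mono_imp_increasing[OF gmono])
  have hg: "(1/2::real)^g n \<le> (1/2)^n" for n using gn by (intro power_decreasing) auto
  have Dsuc: "D (\<sigma> (Suc n)) \<subseteq> D (\<sigma> n)" for n using S[of n] by (simp add: S_def)
  have "\<Inter>(range (\<lambda>n. D (\<sigma> n))) \<noteq> {}"
  proof (rule compact_nest)
    show "compact (D (\<sigma> n))" for n unfolding D_def by (rule compact_dcube)
    show "D (\<sigma> n) \<noteq> {}" for n using ptD by blast
    show "D (\<sigma> n) \<subseteq> D (\<sigma> m)" if "m \<le> n" for m n using Dsuc that by (rule lift_Suc_antimono_le)
  qed
  then obtain y where y: "\<And>n. y \<in> D (\<sigma> n)" by blast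
  have y0: "y \<in> dcube g0 k0" using \<sigma>[of 0] y[of 0] by (auto simp: P_def)
  then have fy: "a < f y" "f y < M" using f(2) by blast+
  have half: "(\<lambda>n. (1/2::real)^n) \<longlonglongrightarrow> 0" by (rule LIMSEQ_realpow_zero) auto
  have "(\<lambda>n. pt (\<sigma> n)) \<longlonglongrightarrow> y"
  proof (rule vec_tendstoI)
    fix i
    have "\<bar>pt (\<sigma> n) $ i - y $ i\<bar> \<le> (1/2)^n" for n
    proof -
      have "linf_dist (pt (\<sigma> n)) y \<le> (1/2)^g n" unfolding g_def
        using ptD y unfolding D_def by (rule dist_in_dcube)
      then show ?thesis using hg[of n] component_le_linf_dist[of "pt (\<sigma> n)" i y] by linarith
    qed
    then show "(\<lambda>n. pt (\<sigma> n) $ i) \<longlonglongrightarrow> y $ i"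
      by (intro Lim_transform_bound[OF _ half, THEN LIM_zero_cancel] always_eventually) auto
  qed
  moreover have "pt (\<sigma> n) \<in> open_unit_cube" for n using ptD[of "\<sigma> n"] \<sigma>[of n] k0(3) unfolding P_def by blast
  moreover have "y \<in> open_unit_cube" using y0 k0(3) by blast
  ultimately have flim: "(\<lambda>n. f (pt (\<sigma> n))) \<longlonglongrightarrow> f y"
    by (intro continuous_on_tendsto_compose[OF f(1)] always_eventually) auto
  have inv: "(\<lambda>n. 1 / (real n + 1)) \<longlonglongrightarrow> 0" using LIMSEQ_inverse_real_of_nat by (simp add: inverse_eq_divide add.commute)
  have "(\<lambda>n. \<delta> n - f (pt (\<sigma> n))) \<longlonglongrightarrow> 0"
  proof (rule Lim_transform_bound[OF _ inv], rule always_eventually, rule allI)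
    fix n
    have "\<bar>\<delta> n - f (pt (\<sigma> n))\<bar> < 1 / (real n + 1)" using S[of n] unfolding S_def by blast
    then show "norm (\<delta> n - f (pt (\<sigma> n))) \<le> norm (1 / (real n + 1))" by simp
  qed
  from tendsto_add[OF this flim] have \<delta>lim: "\<delta> \<longlonglongrightarrow> f y" by simp
  \<comment> \<open>The exponents of the upper estimate have the same limit, as the factors
    absorbing the scale gap tend to 1.\<close>
  have \<delta>lim': "(\<lambda>n. (1 + 1 / (real n + 1)) * \<delta> n) \<longlonglongrightarrow> f y"
    using tendsto_mult[OF tendsto_add[OF tendsto_const inv] \<delta>lim, of 1] by simp
  have yA: "y \<notin> \<Union>(range A)"
  proof
    assume "y \<in> \<Union>(range A)"
    then obtain i where i: "y \<in> A i" by blast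
    obtain n where n: "(1/2::real)^n < t i" using real_arch_pow_inv[OF tpos[of i], of "1/2"] by auto
    have "A i \<inter> dcube (fst (\<sigma> n)) (snd (\<sigma> n)) \<noteq> {}" using i y[of n] by (auto simp: D_def)
    moreover have "light (fst (\<sigma> n)) (snd (\<sigma> n))" using \<sigma>[of n] by (simp add: P_def)
    ultimately have "t i < (1/2)^g n" unfolding g_def by (intro light_imp_small)
    then show False using n hg[of n] by linarith
  qed
  have low: "y \<in> L_set x r \<beta>" if \<beta>: "0 < \<beta>" "\<beta> < f y" for \<beta>
  proof -
    obtain n0 where n0: "\<And>n. n \<ge> n0 \<Longrightarrow> \<beta> < \<delta> n"
      using order_tendstoD(1)[OF \<delta>lim \<beta>(2)] unfolding eventually_sequentially by blast
    let ?I = "{n. linf_dist y (x n) \<le> r n powr \<beta>}"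
    have mI: "m n \<in> ?I" if "n \<ge> n0" for n
    proof -
      have "linf_dist y (x (m n)) \<le> r (m n) powr \<delta> n" using S[of n] y[of "Suc n"] unfolding S_def by blast
      moreover have "r (m n) \<le> 1"
        using S[of n] power_le_one[of "1/2::real" "fst (\<sigma> n)"] by (simp add: S_def)
      then have "r (m n) powr \<delta> n \<le> r (m n) powr \<beta>"
        using n0[OF that] rpos[of "m n"] by (intro powr_mono') auto
      ultimately show ?thesis by simp
    qed
    \<comment> \<open>The radii \<open>r (m n)\<close> are positive and tend to 0, so infinitely
      many different indices occur among the \<open>m n\<close>.\<close>
    have "infinite ?I"
    proof
      assume fin: "finite ?I"
      define b where "b = Min (r ` ?I)"
      have ne: "?I \<noteq> {}" using mI[of n0] by blast
      have "0 < b" using fin ne rpos unfolding b_def by (subst Min_gr_iff) auto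
      then obtain n where n: "(1/2::real)^n < b" using real_arch_pow_inv[of b "1/2"] by auto
      have "b \<le> r (m (max n n0))" unfolding b_def using fin mI by (intro Min_le) auto
      also have "\<dots> < (1/2)^g (max n n0)" using S[of "max n n0"] by (simp add: S_def g_def)
      also have "\<dots> \<le> (1/2)^(max n n0)" by (rule hg)
      also have "\<dots> \<le> (1/2)^n" by (intro power_decreasing) auto
      finally show False using n by linarith
    qed
    then show ?thesis using y0 dcube_subset_unit_cube[OF k0(1)] unfolding L_set_def by blast
  qed
  have up: "\<beta> \<le> f y" if \<beta>: "0 < \<beta>" "y \<in> L_set x r \<beta>" for \<beta>
  proof (rule ccontr)
    assume "\<not> \<beta> \<le> f y"
    then have "\<forall>\<^sub>F n in sequentially. (1 + 1 / (real n + 1)) * \<delta> n < \<beta>"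
      by (intro order_tendstoD(2)[OF \<delta>lim']) simp
    then obtain n1 where n1: "\<And>n. n \<ge> n1 \<Longrightarrow> (1 + 1 / (real n + 1)) * \<delta> n < \<beta>"
      unfolding eventually_sequentially by blast
    have "y \<notin> range x" using yA xA by blast
    then have "infinite {n \<in> irred_idx x. linf_dist y (x n) \<le> r n powr \<beta>}"
      using \<beta> by (intro infinite_irred_idx[OF sys]) (auto simp: L_set_def)
    moreover have "r \<longlonglongrightarrow> 0" using sys by (simp add: is_system_def)
    then have "\<forall>\<^sub>F p in sequentially. r p < (1/2)^g n1" by (intro order_tendstoD) auto
    then obtain p0 where p0: "\<And>p. p \<ge> p0 \<Longrightarrow> r p < (1/2)^g n1" unfolding eventually_sequentially by blast
    ultimately obtain p where p: "p0 < p" "p \<in> irred_idx x" "linf_dist y (x p) \<le> r p powr \<beta>"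
      unfolding infinite_nat_iff_unbounded by blast
    have rp: "r p < (1/2)^g n1" using p0 p(1) by simp
    obtain i where "(1/2::real)^i < r p" using real_arch_pow_inv[OF rpos[of p], of "1/2"] by auto
    then have ex: "(1/2)^g i < r p" using hg[of i] by linarith
    \<comment> \<open>The first cube of the sequence with side below \<open>r p\<close>. The step
      leading to it covers the scale of \<open>p\<close>, and \<open>n1 < l\<close> ensures that the
      exponent of that step is already below \<open>\<beta>\<close>.\<close>
    define l where "l = (LEAST i. (1/2)^g i < r p)"
    have l: "(1/2)^g l < r p" unfolding l_def by (rule LeastI[of "\<lambda>i. (1/2)^g i < r p", OF ex])
    have "n1 < l"
    proof (rule ccontr)
      assume "\<not> n1 < l"
      then have "g l \<le> g n1" using gmono by (simp add: strict_mono_less_eq)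
      then have "(1/2::real)^g n1 \<le> (1/2)^g l" by (intro power_decreasing) auto
      then show False using rp l by linarith
    qed
    then obtain n where n: "l = Suc n" "n1 \<le> n" by (cases l) auto
    have "\<not> (1/2)^g n < r p" using not_less_Least[of n "\<lambda>i. (1/2)^g i < r p"] n(1) unfolding l_def by simp
    then have rpn: "r p \<le> (1/2)^g n" by simp
    then have "r p powr ((1 + 1 / (real n + 1)) * \<delta> n) < linf_dist y (x p)"
      using S[of n] y[of "Suc n"] p(2) l n(1) unfolding S_def g_def by blast
    moreover have "r p powr \<beta> \<le> r p powr ((1 + 1 / (real n + 1)) * \<delta> n)"
    proof (rule powr_mono')
      show "r p \<le> 1" using rpn power_le_one[of "1/2::real" "g n"] by simp
    qed (use n1[OF n(2)] rpos[of p] in auto)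
    ultimately show False using p(3) by linarith
  qed
  have "approx_rate x r y = ereal (f y)"
  proof -
    let ?B = "{\<delta>::real. 0 < \<delta> \<and> y \<in> L_set x r \<delta>}"
    have one: "1 \<in> ?B" using low[of 1] a fy by simp
    then have "?B \<noteq> {}" by blast
    then have ar: "approx_rate x r y = Sup (ereal ` ?B)" unfolding approx_rate_def by (rule if_not_P)
    have "Sup (ereal ` ?B) \<le> ereal (f y)" using up by (intro Sup_least) auto
    moreover have "\<not> Sup (ereal ` ?B) < ereal (f y)"
    proof
      assume "Sup (ereal ` ?B) < ereal (f y)"
      then obtain \<beta> where \<beta>: "Sup (ereal ` ?B) < ereal \<beta>" "ereal \<beta> < ereal (f y)" using ereal_dense2 by blast
      have "ereal 1 \<le> Sup (ereal ` ?B)" using one by (intro Sup_upper) auto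
      then have "ereal 1 < ereal \<beta>" using \<beta>(1) by (rule le_less_trans)
      then have "\<beta> \<in> ?B" using low[of \<beta>] \<beta>(2) by simp
      then have "ereal \<beta> \<le> Sup (ereal ` ?B)" by (intro Sup_upper) auto
      then show False using \<beta>(1) by (metis not_less)
    qed
    ultimately show ?thesis unfolding ar by (simp add: order.antisym not_less)
  qed
  then show ?thesis using that y0 yA by blast
qed

end

text \<open>If the set were null, it would have, together with the points of the system, a cover
  making the starting cube light; \<open>exists_point\<close> would then produce a point of the set
  outside the cover.\<close>

lemma hausdorff_measure_prescribed_rate:
  fixes x :: "nat \<Rightarrow> real^'d"
  assumes sys: "is_system x r" and C2: "C2 x r"
    and W: "open W" "W \<noteq> {}" "W \<subseteq> open_unit_cube"
    and f: "continuous_on open_unit_cube f" "\<And>y. y \<in> W \<Longrightarrow> a < f y \<and> f y < M"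
    and a: "1 < a" and s: "0 < s" "M * s < real CARD('d)"
  shows "hausdorff_measure s {y \<in> W. approx_rate x r y = ereal (f y)} \<noteq> 0" (is "hausdorff_measure s ?E \<noteq> 0")
proof
  assume null: "hausdorff_measure s ?E = 0"
  let ?d = "CARD('d)"
  obtain \<phi> N \<kappa> \<Delta> where phi: "\<phi> \<in> Phi_class" and N: "C1_with x r N"
    and \<kappa>: "continuous_on {1<..} \<kappa>" "\<forall>t>1. 0 < \<kappa> t \<and> \<kappa> t \<le> (1::real)"
    and \<Delta>: "{1<..} \<subseteq> closure \<Delta>"
    and Q: "\<forall>\<delta>\<in>\<Delta>. \<forall>g kU. valid_corner g kU \<longrightarrow>
           infinite {j. g \<le> j \<and>
              real (card (Q_set x r \<phi> N g kU j \<delta>))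
                \<ge> \<kappa> \<delta> * 2 powr (real CARD('d) * (real j - real g))}"
    using C2 unfolding C2_def by blast
  have aM: "a < M" using W(2) f(2) by fastforce
  \<comment> \<open>\<kappa> is continuous and positive on a compact interval, so its minimum is a
    share valid for all exponents in use.\<close>
  have "\<exists>u\<in>{a..M}. \<forall>v\<in>{a..M}. \<kappa> u \<le> \<kappa> v"
    using aM a by (intro continuous_attains_inf continuous_on_subset[OF \<kappa>(1)]) auto
  then obtain u where u: "u \<in> {a..M}" "\<And>v. v \<in> {a..M} \<Longrightarrow> \<kappa> u \<le> \<kappa> v" by blast
  define \<kappa>0 where "\<kappa>0 = \<kappa> u"
  have \<kappa>0: "0 < \<kappa>0" "\<kappa>0 \<le> 1" using u(1) a \<kappa>(2) by (auto simp: \<kappa>0_def)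
  define \<sigma> where "\<sigma> = (2 powr (1 - a))^?d"
  have \<sigma>: "0 < \<sigma>" "\<sigma> < 1"
  proof -
    have "2 powr (1 - a) < (1::real)" using a by (simp add: powr_less_one)
    then show "0 < \<sigma>" "\<sigma> < 1" by (simp_all add: \<sigma>_def power_less_one_iff)
  qed
  have smN: "summable (\<lambda>k. real (N k) * \<sigma>^k)" by (rule C1_with_summable[OF N \<sigma>])
  obtain g1 where g1: "\<And>n. n \<ge> g1 \<Longrightarrow> norm (\<Sum>i. real (N (i + n)) * \<sigma>^(i + n)) < \<kappa>0 / (4 * 30^?d)"
    using suminf_exist_split[OF _ smN, of "\<kappa>0 / (4 * 30^?d)"] \<kappa>0 by auto
  obtain g0 k0 where k0: "max 1 g1 \<le> g0" "valid_corner g0 k0" "dcube g0 k0 \<subseteq> W"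
    using open_contains_dcube[OF W] .
  \<comment> \<open>Exactly the mass allowed in a light cube of generation
    \<open>g0\<close>.\<close>
  define e where "e = \<kappa>0 / (4 * 3^?d) * 2 powr (- real g0 * s)"
  have e: "0 < e" using \<kappa>0 by (simp add: e_def)
  have null': "hausdorff_measure s (?E \<union> range x) = 0"
    by (rule hausdorff_null_Un[OF null hausdorff_null_range[OF s(1)] s(1)])
  obtain A :: "nat \<Rightarrow> (real^'d) set" and t where A: "?E \<union> range x \<subseteq> \<Union>(range A)" "\<And>i. 0 < t i"
      "\<And>i p q. p \<in> A i \<Longrightarrow> q \<in> A i \<Longrightarrow> linf_dist p q \<le> t i"
      "summable (\<lambda>i. t i powr s)" "(\<Sum>i. t i powr s) < e"
    by (rule hausdorff_null_cover[OF null' s(1) e]) (rule that)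
  interpret ubiquity x r N \<phi> a M s \<kappa>0 A t g0
  proof (unfold_locales; (fact sys N phi a s \<kappa>0 A(2) A(4))?)
    show "linf_dist p q \<le> t i" if "p \<in> A i" "q \<in> A i" for i p q by (rule A(3)[OF that])
    show "1 \<le> g0" using k0(1) by simp
    fix n
    have "(\<Sum>k\<in>{g0..<n}. real (N k) * \<sigma>^k) = (\<Sum>i<n-g0. real (N (i + g0)) * \<sigma>^(i + g0))"
      using sum.shift_bounds_nat_ivl[of "\<lambda>k. real (N k) * \<sigma>^k" 0 g0 "n - g0"]
      by (cases "g0 \<le> n") (simp_all add: atLeast0LessThan)
    also have "\<dots> \<le> (\<Sum>i. real (N (i + g0)) * \<sigma>^(i + g0))"
      using \<sigma> summable_ignore_initial_segment[OF smN, of g0] by (intro sum_le_suminf) auto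
    also have "\<dots> < \<kappa>0 / (4 * 30^?d)" using g1[of g0] k0(1) by auto
    finally show "30^?d * (\<Sum>k\<in>{g0..<n}. real (N k) * ((2 powr (1 - a))^?d)^k) \<le> \<kappa>0 / 4"
      unfolding \<sigma>_def[symmetric] by (simp add: field_simps)
  qed
  have light: "light g0 k0"
  proof -
    have "cover_mass A t s (dcube g0 k0) \<le> (\<Sum>i. t i powr s)"
      unfolding cover_mass_def by (intro suminf_le cover_mass_summable A(4)) auto
    then show ?thesis unfolding light_def c_def e_def[symmetric] using A(5) by simp
  qed
  obtain y where y: "y \<in> dcube g0 k0" "y \<notin> \<Union>(range A)" "approx_rate x r y = ereal (f y)"
  proof (rule exists_point[OF \<Delta> _ k0(2) light _ f(1)])
    fix \<delta> g and kU :: "nat^'d" assume h: "\<delta> \<in> \<Delta>" "a < \<delta>" "\<delta> < M" "valid_corner g kU"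
    let ?S = "\<lambda>\<kappa>. {j. g \<le> j \<and> \<kappa> * 2 powr (real ?d * (real j - real g)) \<le> real (card (Q_set x r \<phi> N g kU j \<delta>))}"
    have "\<kappa>0 \<le> \<kappa> \<delta>" unfolding \<kappa>0_def using h by (intro u(2)) auto
    then have "?S (\<kappa> \<delta>) \<subseteq> ?S \<kappa>0" by (auto intro: order_trans[OF mult_right_mono])
    moreover have "infinite (?S (\<kappa> \<delta>))" using Q h by blast
    ultimately show "infinite (?S \<kappa>0)" using infinite_super by blast
  next
    show "dcube g0 k0 \<subseteq> open_unit_cube" using k0(3) W(3) by blast
    show "a < f y \<and> f y < M" if "y \<in> dcube g0 k0" for y using f(2) k0(3) that by blast
    show "range x \<subseteq> \<Union>(range A)" using A(1) by blast
  qed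
  then have "y \<in> ?E" using k0(3) by blast
  then show False using A(1) y(2) by blast
qed

section \<open>Density and dimension\<close>

lemma open_sublevel_superlevel:
  fixes f :: "'a::topological_space \<Rightarrow> real"
  assumes "open W" "continuous_on W f"
  shows "open {y \<in> W. f y < c}" "open {y \<in> W. c < f y}"
proof -
  have "open (f -` {..<c} \<inter> W)" "open (f -` {c<..} \<inter> W)"
    using assms continuous_on_open_vimage[OF assms(1), of f] by auto
  moreover have "f -` {..<c} \<inter> W = {y \<in> W. f y < c}" "f -` {c<..} \<inter> W = {y \<in> W. c < f y}" by auto
  ultimately show "open {y \<in> W. f y < c}" "open {y \<in> W. c < f y}" by simp_all
qed

lemma open_open_unit_cube: "open (open_unit_cube :: (real^'d) set)"
proof -
  have "(open_unit_cube :: (real^'d) set) = box (\<chi> i. 0) (\<chi> i. 1)"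
    by (auto simp: open_unit_cube_def mem_box_cart)
  then show ?thesis by (metis open_box)
qed

lemma infinite_close_imp_rate_ge:
  "\<lbrakk>0 < \<delta>; y \<in> L_set x r \<delta>\<rbrakk> \<Longrightarrow> ereal \<delta> \<le> approx_rate x r y"
  unfolding approx_rate_def by (auto intro!: Sup_upper)

lemma L_set_antimono:
  assumes sys: "is_system x r" and le: "\<delta> \<le> \<delta>'"
  shows "L_set x r \<delta>' \<subseteq> L_set x r \<delta>"
proof
  fix y assume y: "y \<in> L_set x r \<delta>'"
  have rpos: "\<And>n. 0 < r n" and "r \<longlonglongrightarrow> 0" using sys by (auto simp: is_system_def)
  then have "\<forall>\<^sub>F n in sequentially. r n < 1" by (intro order_tendstoD) auto
  then obtain n0 where n0: "\<And>n. n \<ge> n0 \<Longrightarrow> r n < 1" unfolding eventually_sequentially by blast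
  have "{n. linf_dist y (x n) \<le> r n powr \<delta>'} \<subseteq> {n. linf_dist y (x n) \<le> r n powr \<delta>} \<union> {..<n0}"
  proof
    fix n assume n: "n \<in> {n. linf_dist y (x n) \<le> r n powr \<delta>'}"
    have "r n powr \<delta>' \<le> r n powr \<delta>" if "n \<ge> n0"
      using n0[OF that] rpos[of n] le by (intro powr_mono') auto
    then show "n \<in> {n. linf_dist y (x n) \<le> r n powr \<delta>} \<union> {..<n0}"
      using n by (cases "n \<ge> n0") auto
  qed
  moreover have "infinite {n. linf_dist y (x n) \<le> r n powr \<delta>'}" using y by (simp add: L_set_def)
  ultimately have "infinite {n. linf_dist y (x n) \<le> r n powr \<delta>}"
    using finite_subset by (metis finite_Un finite_lessThan)
  then show "y \<in> L_set x r \<delta>" using y by (simp add: L_set_def)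
qed

lemma rate_gt_imp_L_set:
  assumes sys: "is_system x r" and \<delta>: "0 \<le> \<delta>" "ereal \<delta> < approx_rate x r y"
  shows "y \<in> L_set x r \<delta>"
proof -
  let ?B = "{\<delta>::real. 0 < \<delta> \<and> y \<in> L_set x r \<delta>}"
  have "?B \<noteq> {}" using \<delta> unfolding approx_rate_def by (auto split: if_splits)
  then have "ereal \<delta> < Sup (ereal ` ?B)" using \<delta>(2) unfolding approx_rate_def by (simp only: if_False)
  then obtain \<delta>' where "\<delta>' \<in> ?B" "\<delta> < \<delta>'" unfolding less_Sup_iff by auto
  then show ?thesis using L_set_antimono[OF sys, of \<delta> \<delta>'] by auto
qed

text \<open>Some \<open>\<delta> < m\<close> still satisfies \<open>d < \<delta> * s\<close>. A rate
  of at least \<open>m\<close> puts \<open>E\<close> into \<open>L_set\<close> at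
  \<open>\<delta>\<close>, which is null by \<open>hausdorff_null_L_set\<close>.\<close>

lemma hausdorff_null_rate_ge:
  fixes x :: "nat \<Rightarrow> real^'d"
  assumes sys: "is_system x r" and C1: "C1 x r" and m: "0 < m" and s: "real CARD('d) / m < s"
    and E: "\<And>y. y \<in> E \<Longrightarrow> ereal m \<le> approx_rate x r y"
  shows "hausdorff_measure s E = 0"
proof -
  have d: "0 < real CARD('d)" by simp
  have "0 < real CARD('d) / m" using m d by (rule divide_pos_pos[rotated])
  then have s0: "0 < s" using s by linarith
  have "real CARD('d) / s < m" using s m s0 by (simp add: field_simps)
  then obtain \<delta> where \<delta>: "real CARD('d) / s < \<delta>" "\<delta> < m" using dense by blast
  have \<delta>0: "0 < \<delta>" using \<delta>(1) divide_pos_pos[OF d s0] by linarith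
  have "real CARD('d) < \<delta> * s" using \<delta>(1) s0 by (simp add: field_simps)
  then have "hausdorff_measure s (L_set x r \<delta>) = 0" by (rule hausdorff_null_L_set[OF sys C1 \<delta>0])
  moreover have "E \<subseteq> L_set x r \<delta>"
  proof
    fix y assume "y \<in> E"
    then have "ereal \<delta> < approx_rate x r y" using E \<delta>(2) by (meson ereal_less_eq(3) less_ereal.simps(1) less_le_trans)
    then show "y \<in> L_set x r \<delta>" using rate_gt_imp_L_set[OF sys] \<delta>0 by simp
  qed
  ultimately show ?thesis using hausdorff_null_subset s0 by blast
qed

lemma rate_ge_1:
  assumes sys: "is_system x r" and y: "y \<in> open_unit_cube"
    and ls: "infinite {n. y \<in> cball_inf (x n) (r n)}"
  shows "ereal 1 \<le> approx_rate x r y"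
proof -
  have "0 < r n" for n using sys by (simp add: is_system_def)
  then have "{n. y \<in> cball_inf (x n) (r n)} = {n. linf_dist y (x n) \<le> r n powr 1}"
    by (simp add: cball_inf_def linf_dist_commute less_imp_le)
  then have "y \<in> L_set x r 1"
    using ls y unfolding L_set_def
    by (auto simp: open_unit_cube_def closed_unit_cube_def less_imp_le)
  then show ?thesis by (intro infinite_close_imp_rate_ge) auto
qed

text \<open>On the open cube every rate is at least 1 by the limsup hypothesis, and points of larger
  rate lie in countably many sets of zero \<open>d\<close>-dimensional measure. If rate 1 were null
  as well, the open set \<open>W\<close> would be negligible.\<close>

lemma hausdorff_measure_rate_1:
  fixes x :: "nat \<Rightarrow> real^'d"
  assumes sys: "is_system x r" and C1: "C1 x r"
    and ls: "\<forall>y \<in> open_unit_cube. infinite {n. y \<in> cball_inf (x n) (r n)}"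
    and W: "open W" "W \<noteq> {}" "W \<subseteq> open_unit_cube" and s: "0 < s" "s \<le> real CARD('d)"
  shows "hausdorff_measure s {y \<in> W. approx_rate x r y = ereal 1} \<noteq> 0" (is "hausdorff_measure s ?E \<noteq> 0")
proof
  assume "hausdorff_measure s ?E = 0"
  then have "negligible ?E" using s by (rule hausdorff_null_imp_negligible)
  moreover have "negligible (\<Union>n::nat. L_set x r (1 + 1 / (real n + 1)))"
  proof (rule negligible_countable_Union, simp, clarify)
    fix n :: nat
    have "real CARD('d) < (1 + 1 / (real n + 1)) * real CARD('d)" by (simp add: distrib_right)
    then have "hausdorff_measure (real CARD('d)) (L_set x r (1 + 1 / (real n + 1))) = 0"
      by (intro hausdorff_null_L_set[OF sys C1]) (auto intro: add_pos_pos)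
    then show "negligible (L_set x r (1 + 1 / (real n + 1)))"
      by (rule hausdorff_null_imp_negligible) auto
  qed
  moreover have "W \<subseteq> ?E \<union> (\<Union>n::nat. L_set x r (1 + 1 / (real n + 1)))"
  proof
    fix y assume y: "y \<in> W"
    then have ge: "ereal 1 \<le> approx_rate x r y" using rate_ge_1[OF sys] ls W(3) by blast
    show "y \<in> ?E \<union> (\<Union>n::nat. L_set x r (1 + 1 / (real n + 1)))"
    proof (cases "approx_rate x r y = ereal 1")
      case False
      then have "ereal 1 < approx_rate x r y" using ge by simp
      then obtain \<beta> where \<beta>: "ereal 1 < ereal \<beta>" "ereal \<beta> < approx_rate x r y" using ereal_dense2 by blast
      then obtain n where n: "inverse (real (Suc n)) < \<beta> - 1" using reals_Archimedean[of "\<beta> - 1"] by auto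
      have "y \<in> L_set x r \<beta>" using rate_gt_imp_L_set[OF sys _ \<beta>(2)] \<beta>(1) by simp
      moreover have "1 + 1 / (real n + 1) \<le> \<beta>" using n by (simp add: inverse_eq_divide add.commute)
      ultimately have "y \<in> L_set x r (1 + 1 / (real n + 1))" using L_set_antimono[OF sys] by blast
      then show ?thesis by blast
    qed (use y in blast)
  qed
  ultimately have "negligible W" by (meson negligible_Un negligible_subset)
  then show False using open_not_negligible W by blast
qed

text \<open>Near \<open>w\<close> the values of \<open>f\<close> stay below some \<open>M\<close>
  with \<open>M * s < d\<close>. Either \<open>f\<close> exceeds 1 at some point there and the
  nested construction applies around it, or \<open>f\<close> is constantly 1 and the Lebesgue
  argument applies.\<close>

lemma hausdorff_measure_rate_eq:
  fixes x :: "nat \<Rightarrow> real^'d"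
  assumes sys: "is_system x r" and C1: "C1 x r" and C2: "C2 x r"
    and ls: "\<forall>y \<in> open_unit_cube. infinite {n. y \<in> cball_inf (x n) (r n)}"
    and f: "continuous_on open_unit_cube f" "\<forall>y \<in> open_unit_cube. 1 \<le> f y"
    and W: "open W" "W \<subseteq> open_unit_cube" and w: "w \<in> W" and s: "0 < s" "f w * s < real CARD('d)"
  shows "hausdorff_measure s {y \<in> W. approx_rate x r y = ereal (f y)} \<noteq> 0"
proof -
  have "f w < real CARD('d) / s" using s by (simp add: field_simps)
  then obtain M where M: "f w < M" "M < real CARD('d) / s" using dense by blast
  have Ms: "M * s < real CARD('d)" using M(2) s by (simp add: field_simps)
  have fW: "continuous_on W f" using f(1) W(2) by (rule continuous_on_subset)
  define V where "V = {y \<in> W. f y < M}"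
  have Vo: "open V" unfolding V_def by (rule open_sublevel_superlevel[OF W(1) fW])
  have wV: "w \<in> V" using w M by (simp add: V_def)
  have VW: "V \<subseteq> W" by (auto simp: V_def)
  have sd: "s \<le> real CARD('d)"
  proof -
    have "1 \<le> f w" using f(2) w W(2) by blast
    then have "1 * s \<le> f w * s" using s by (intro mult_right_mono) auto
    then show ?thesis using s by linarith
  qed
  have "\<exists>V'\<subseteq>W. hausdorff_measure s {y \<in> V'. approx_rate x r y = ereal (f y)} \<noteq> 0"
  proof (cases "\<exists>v\<in>V. f v \<noteq> 1")
    case True
    then obtain v where v: "v \<in> V" "1 < f v" using f(2) VW W(2) by fastforce
    \<comment> \<open>Strictly between 1 and \<open>f v\<close>, so that \<open>f > a > 1\<close> on
      an open set around \<open>v\<close>.\<close>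
    define a where "a = (1 + f v) / 2"
    define U where "U = {y \<in> V. a < f y}"
    have "continuous_on V f" using fW VW by (rule continuous_on_subset)
    then have "open U" unfolding U_def by (rule open_sublevel_superlevel[OF Vo])
    moreover have "v \<in> U" using v by (simp add: U_def a_def)
    moreover have "U \<subseteq> open_unit_cube" using VW W(2) by (auto simp: U_def)
    moreover have "1 < a" using v by (simp add: a_def)
    ultimately have "hausdorff_measure s {y \<in> U. approx_rate x r y = ereal (f y)} \<noteq> 0"
      using s Ms by (intro hausdorff_measure_prescribed_rate[OF sys C2 _ _ _ f(1), of U a M]) (auto simp: U_def V_def)
    then show ?thesis using VW by (intro exI[of _ U]) (auto simp: U_def)
  next
    case False
    then have "{y \<in> V. approx_rate x r y = ereal (f y)} = {y \<in> V. approx_rate x r y = ereal 1}" by auto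
    moreover have "hausdorff_measure s {y \<in> V. approx_rate x r y = ereal 1} \<noteq> 0"
      using wV VW W(2) s sd by (intro hausdorff_measure_rate_1[OF sys C1 ls Vo]) auto
    ultimately show ?thesis using VW by auto
  qed
  then obtain V' where V': "V' \<subseteq> W" "hausdorff_measure s {y \<in> V'. approx_rate x r y = ereal (f y)} \<noteq> 0" by blast
  have "{y \<in> V'. approx_rate x r y = ereal (f y)} \<subseteq> {y \<in> W. approx_rate x r y = ereal (f y)}" using V'(1) by blast
  then show ?thesis using hausdorff_null_subset[OF _ _ s(1)] V'(2) by blast
qed

text \<open>The infimum ranges over \<open>s \<ge> 0\<close>, whereas \<open>low\<close> speaks of
  positive exponents. A null exponent below \<open>D\<close>, possibly 0, is first moved up to its
  midpoint with \<open>D\<close>.\<close>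

lemma hausdorff_dim_eqI:
  fixes E :: "(real^'d) set"
  assumes up: "\<And>s. D < s \<Longrightarrow> hausdorff_measure s E = 0"
    and low: "\<And>s. 0 < s \<Longrightarrow> s < D \<Longrightarrow> hausdorff_measure s E \<noteq> 0" and D: "0 < D"
  shows "hausdorff_dim E = D"
proof -
  let ?S = "{s. 0 \<le> s \<and> hausdorff_measure s E = 0}"
  have lb: "D \<le> s" if "s \<in> ?S" for s
  proof (rule ccontr)
    assume "\<not> D \<le> s"
    then have h: "s \<le> (s + D) / 2" "0 < (s + D) / 2" "(s + D) / 2 < D" using that D by auto
    then have "hausdorff_measure ((s + D) / 2) E = 0"
      using that hausdorff_null_exponent_mono by blast
    then show False using low h by blast
  qed
  have mem: "s \<in> ?S" if "D < s" for s using up[OF that] that D by simp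
  have bdd: "bdd_below ?S" using lb by (intro bdd_belowI) blast
  have "Inf ?S \<le> D"
  proof (rule field_le_epsilon)
    fix e :: real assume "0 < e"
    then have "D + e \<in> ?S" by (intro mem) simp
    then show "Inf ?S \<le> D + e" using bdd by (rule cInf_lower)
  qed
  moreover have "D \<le> Inf ?S" using mem[of "D + 1"] lb by (intro cInf_greatest) auto
  ultimately show ?thesis unfolding hausdorff_dim_def by (rule antisym)
qed

theorem theorem1:
  fixes x :: "nat \<Rightarrow> real^'d" and r :: "nat \<Rightarrow> real"
    and \<Omega> :: "(real^'d) set" and f :: "real^'d \<Rightarrow> real"
  assumes sys: "is_system x r"
    and inside: "\<forall>n. x n \<in> open_unit_cube"
    and limsup: "\<forall>y \<in> open_unit_cube. infinite {n. y \<in> cball_inf (x n) (r n)}"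
    and c1: "C1 x r" and c2: "C2 x r"
    and \<Omega>_compact: "compact \<Omega>" and \<Omega>_ne: "\<Omega> \<noteq> {}"
    and \<Omega>_sub: "\<Omega> \<subseteq> open_unit_cube"
    and \<Omega>_reg: "closure (interior \<Omega>) = \<Omega>"
    and f_cont: "continuous_on open_unit_cube f"
    and f_ge: "\<forall>y \<in> open_unit_cube. 1 \<le> f y"
  shows "\<Omega> \<subseteq> closure {y \<in> \<Omega>. approx_rate x r y \<ge> ereal (f y)}
       \<and> \<Omega> \<subseteq> closure {y \<in> \<Omega>. approx_rate x r y = ereal (f y)}
       \<and> hausdorff_dim {y \<in> \<Omega>. approx_rate x r y \<ge> ereal (f y)}
           = real CARD('d) / Inf (f ` \<Omega>)
       \<and> hausdorff_dim {y \<in> \<Omega>. approx_rate x r y = ereal (f y)}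
           = real CARD('d) / Inf (f ` \<Omega>)"
proof -
  let ?L = "{y \<in> \<Omega>. approx_rate x r y \<ge> ereal (f y)}"
  let ?T = "{y \<in> \<Omega>. approx_rate x r y = ereal (f y)}"
  have TL: "?T \<subseteq> ?L" by auto
  have rate: "hausdorff_measure s {y \<in> W. approx_rate x r y = ereal (f y)} \<noteq> 0"
    if "open W" "W \<subseteq> interior \<Omega>" "w \<in> W" "0 < s" "f w * s < real CARD('d)" for W w s
    using that \<Omega>_sub interior_subset[of \<Omega>]
    by (intro hausdorff_measure_rate_eq[OF sys c1 c2 limsup f_cont f_ge]) auto
  \<comment> \<open>A set of nonzero measure is nonempty, so \<open>rate\<close> is applied to the
    interior of \<open>\<Omega>\<close> inside small balls.\<close>
  have dense: "\<Omega> \<subseteq> closure ?T"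
  proof
    fix z assume "z \<in> \<Omega>"
    show "z \<in> closure ?T"
      unfolding closure_approachable
    proof (intro allI impI)
      fix e :: real assume e: "0 < e"
      have "z \<in> closure (interior \<Omega>)" using \<open>z \<in> \<Omega>\<close> \<Omega>_reg by simp
      then obtain w where w: "w \<in> interior \<Omega>" "dist w z < e" using e unfolding closure_approachable by blast
      define W where "W = interior \<Omega> \<inter> ball z e"
      have fw: "1 \<le> f w" using f_ge w(1) \<Omega>_sub interior_subset by blast
      \<comment> \<open>This exponent makes \<open>f w * s\<close> equal to 1/2, below the
        dimension.\<close>
      have "hausdorff_measure (1 / (2 * f w)) {y \<in> W. approx_rate x r y = ereal (f y)} \<noteq> 0"
      proof (rule rate)
        show "w \<in> W" using w by (simp add: W_def dist_commute)
        have "1 \<le> real CARD('d)" by (simp add: Suc_leI)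
        then have "1 / 2 < real CARD('d)" by linarith
        then show "f w * (1 / (2 * f w)) < real CARD('d)" using fw by simp
      qed (use fw in \<open>auto simp: W_def\<close>)
      moreover have "hausdorff_measure (1 / (2 * f w)) ({} :: (real^'d) set) = 0"
        using fw by (intro hausdorff_null_subset[OF hausdorff_null_range[of _ x]]) auto
      ultimately have "{y \<in> W. approx_rate x r y = ereal (f y)} \<noteq> {}" by metis
      then obtain y where "y \<in> W" "approx_rate x r y = ereal (f y)" by blast
      then show "\<exists>y\<in>?T. dist y z < e" using interior_subset[of \<Omega>] by (auto simp: W_def dist_commute)
    qed
  qed
  have f\<Omega>: "continuous_on \<Omega> f" using f_cont \<Omega>_sub by (rule continuous_on_subset)
  obtain z where z: "z \<in> \<Omega>" "\<And>y. y \<in> \<Omega> \<Longrightarrow> f z \<le> f y"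
    using continuous_attains_inf[OF \<Omega>_compact \<Omega>_ne f\<Omega>] by blast
  have inf: "Inf (f ` \<Omega>) = f z" using z by (intro cInf_eq_minimum) auto
  have fz: "1 \<le> f z" using z(1) \<Omega>_sub f_ge by blast
  have up: "hausdorff_measure s ?L = 0" if "real CARD('d) / f z < s" for s
  proof (rule hausdorff_null_rate_ge[OF sys c1 _ that])
    fix y assume y: "y \<in> ?L"
    then have "ereal (f z) \<le> ereal (f y)" using z(2) by simp
    also have "\<dots> \<le> approx_rate x r y" using y by simp
    finally show "ereal (f z) \<le> approx_rate x r y" .
  qed (use fz in simp)
  have low: "hausdorff_measure s ?T \<noteq> 0" if s: "0 < s" "s < real CARD('d) / f z" for s
  proof -
    \<comment> \<open>The minimum may be attained only on the boundary; as \<open>\<Omega>\<close>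
      is the closure of its interior, there are interior points near it where \<open>f\<close> is
      still below \<open>d / s\<close>.\<close>
    let ?V = "{y \<in> open_unit_cube. f y < real CARD('d) / s}"
    have "f z < real CARD('d) / s" using s fz by (simp add: field_simps)
    then have "z \<in> ?V \<inter> closure (interior \<Omega>)" using z(1) \<Omega>_reg \<Omega>_sub by auto
    moreover have "open ?V" by (rule open_sublevel_superlevel[OF open_open_unit_cube f_cont])
    ultimately have "?V \<inter> interior \<Omega> \<noteq> {}" using open_Int_closure_eq_empty by blast
    then obtain w where w: "w \<in> interior \<Omega>" "f w < real CARD('d) / s" by blast
    have "f w * s < real CARD('d)" using w(2) s by (simp add: field_simps)
    then have "hausdorff_measure s {y \<in> interior \<Omega>. approx_rate x r y = ereal (f y)} \<noteq> 0"
      using w(1) s(1) by (intro rate) auto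
    moreover have "{y \<in> interior \<Omega>. approx_rate x r y = ereal (f y)} \<subseteq> ?T" using interior_subset by blast
    ultimately show ?thesis using hausdorff_null_subset[OF _ _ s(1)] by blast
  qed
  have D: "0 < real CARD('d) / f z" using fz by simp
  \<comment> \<open>Nullity above \<open>d / f z\<close> is known for the larger set and its failure
    below for the smaller; the inclusion \<open>TL\<close> transfers both.\<close>
  have "hausdorff_dim ?L = real CARD('d) / f z"
    using up low hausdorff_null_subset[OF _ TL] by (intro hausdorff_dim_eqI D) blast+
  moreover have "hausdorff_dim ?T = real CARD('d) / f z"
  proof (rule hausdorff_dim_eqI[OF _ low D])
    show "hausdorff_measure s ?T = 0" if "real CARD('d) / f z < s" for s
      using hausdorff_null_subset[OF up[OF that] TL] that D by linarith
  qed
  ultimately show ?thesis using dense closure_mono[OF TL] unfolding inf by blast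
qed

end
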